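(* Let $F=F(x,y)$ be a Finsler metric on an open neighborhood $\mathcal{U}$ of the origin in $\mathbb{R}^n$. Then $F$ is projectively flat with zero flag curvature if and only if there exist a Minkowski norm $\psi=\psi(y)$ and a positively homogeneous function $\phi=\phi(y)$ of degree one on $\mathbb{R}^n$, $C^\infty$ on $\mathbb{R}^n\setminus\{0\}$, such that $$F=\psi(y+xP)\,\{1+P_{y^k}x^k\},$$ where $P=P(x,y)$ satisfies $P=\phi(y+xP)$. In this case, $\psi(y)=F(0,y)$ and $\phi(y)=P(0,y)=\dfrac{F_{x^k}y^k}{2F}\Big|_{x=0}$.
   Context: Summation over repeated indices is understood; subscripts $x^k,y^k$ denote partial derivatives; $y+xP$ denotes the vector with components $y^k+x^kP(x,y)$. The tangent bundle of an open set $\mathcal{U}\subset\mathbb{R}^n$ is identified with $\mathcal{U}\times\mathbb{R}^n$. A function $h$ of $y$ is positively homogeneous of degree one if $h(\lambda y)=\lambda h(y)$ for all $\lambda>0$. A Minkowski norm on $\mathbb{R}^n$ is a nonnegative function $\psi$, $C^\infty$ on $\mathbb{R}^n\setminus\{0\}$, with $\psi(y)=0$ iff $y=0$, positively homogeneous of degree one, and such that the matrix $[\frac12\psi^2]_{y^iy^j}(y)$ is positive definite for $y\neq0$. A Finsler metric on $\mathcal{U}$ is a function $F$ on $\mathcal{U}\times\mathbb{R}^n$, $C^\infty$ on $\mathcal{U}\times(\mathbb{R}^n\setminus\{0\})$, such that $F(x,\cdot)$ is a Minkowski norm for each $x$. With $g_{ij}=[\frac12F^2]_{y^iy^j}$ and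 $(g^{ij})=(g_{ij})^{-1}$, the geodesic coefficients are $G^i=\frac14 g^{il}\{[F^2]_{x^my^l}y^m-[F^2]_{x^l}\}$. $F$ is projectively flat on $\mathcal{U}$ if all its geodesics are straight lines, equivalently $G^i=P\,y^i$ with $P=F_{x^k}y^k/(2F)$ (the projective factor). For a tangent plane $\Pi=\mathrm{span}\{y,u\}$ the flag curvature is ${\bf K}(\Pi,y)=\dfrac{g_{im}R^i_{\ k}u^ku^m}{F^2g_{ij}u^iu^j-[g_{ij}y^iu^j]^2}$, where $R^i_{\ k}=2\frac{\partial G^i}{\partial x^k}-y^j\frac{\partial^2G^i}{\partial x^j\partial y^k}+2G^j\frac{\partial^2G^i}{\partial y^j\partial y^k}-\frac{\partial G^i}{\partial y^j}\frac{\partial G^j}{\partial y^k}$; for projectively flat $F$ one has ${\bf K}=(P^2-P_{x^m}y^m)/F^2$. Zero flag curvature means ${\bf K}=0$.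
   Formalization: The neighborhood U is assumed connected and n ≥ 2: the equivalence fails on disconnected U (F=|y| near 0, 2|y| on another component) and for n=1, where there are no tangent planes (F=(1+x²)|y|). *)

theory Defs
  imports "HOL-Analysis.Analysis"
begin

text \<open>Only meant for open \<open>S\<close>.\<close>

fun C_k_on :: "nat \<Rightarrow> 'a::euclidean_space set \<Rightarrow> ('a \<Rightarrow> real) \<Rightarrow> bool" where
  "C_k_on 0 S f \<longleftrightarrow> continuous_on S f"
| "C_k_on (Suc k) S f \<longleftrightarrow>
     (\<forall>z\<in>S. f differentiable (at z)) \<and> (\<forall>v. C_k_on k S (\<lambda>z. frechet_derivative f (at z) v))"

definition C_infinity_on :: "'a::euclidean_space set \<Rightarrow> ('a \<Rightarrow> real) \<Rightarrow> bool" where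
  "C_infinity_on S f \<longleftrightarrow> (\<forall>k. C_k_on k S f)"

definition pd :: "'n \<Rightarrow> (real^'n \<Rightarrow> real) \<Rightarrow> real^'n \<Rightarrow> real" where
  "pd k f z = frechet_derivative f (at z) (axis k 1)"

text \<open>
  A function on the tangent bundle \<open>U \<times> \<real>\<^sup>n\<close> is a curried function whose values at base points
  outside \<open>U\<close> are irrelevant. The set below is the tangent bundle without its zero section.
\<close>

abbreviation slit_tangent_bundle :: "(real^'n) set \<Rightarrow> ((real^'n) \<times> (real^'n)) set" where
  "slit_tangent_bundle U \<equiv> U \<times> (UNIV - {0})"

abbreviation pd_x :: "'n \<Rightarrow> (real^'n \<Rightarrow> real^'n \<Rightarrow> real) \<Rightarrow> real^'n \<Rightarrow> real^'n \<Rightarrow> real" where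
  "pd_x k f \<equiv> (\<lambda>x y. pd k (\<lambda>x'. f x' y) x)"

abbreviation pd_y :: "'n \<Rightarrow> (real^'n \<Rightarrow> real^'n \<Rightarrow> real) \<Rightarrow> real^'n \<Rightarrow> real^'n \<Rightarrow> real" where
  "pd_y k f \<equiv> (\<lambda>x y. pd k (f x) y)"

definition pos_homogeneous :: "(real^'n \<Rightarrow> real) \<Rightarrow> bool" where
  "pos_homogeneous h \<longleftrightarrow> (\<forall>y. \<forall>r>0. h (r *\<^sub>R y) = r * h y)"

definition fundamental_matrix :: "(real^'n \<Rightarrow> real) \<Rightarrow> real^'n \<Rightarrow> real^'n^'n" where
  "fundamental_matrix \<psi> y = (\<chi> i j. pd j (pd i (\<lambda>z. (\<psi> z)\<^sup>2 / 2)) y)"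

definition Minkowski_norm :: "(real^'n \<Rightarrow> real) \<Rightarrow> bool" where
  "Minkowski_norm \<psi> \<longleftrightarrow>
     (\<forall>y. 0 \<le> \<psi> y) \<and>
     C_infinity_on (UNIV - {0}) \<psi> \<and>
     (\<forall>y. \<psi> y = 0 \<longleftrightarrow> y = 0) \<and>
     pos_homogeneous \<psi> \<and>
     (\<forall>y. y \<noteq> 0 \<longrightarrow> (\<forall>v. v \<noteq> 0 \<longrightarrow> 0 < v \<bullet> (fundamental_matrix \<psi> y *v v)))"

definition Finsler_metric :: "(real^'n) set \<Rightarrow> (real^'n \<Rightarrow> real^'n \<Rightarrow> real) \<Rightarrow> bool" where
  "Finsler_metric U F \<longleftrightarrow>
     C_infinity_on (slit_tangent_bundle U) (\<lambda>(x, y). F x y) \<and>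
     (\<forall>x\<in>U. Minkowski_norm (F x))"

definition metric_tensor :: "(real^'n \<Rightarrow> real^'n \<Rightarrow> real) \<Rightarrow> real^'n \<Rightarrow> real^'n \<Rightarrow> real^'n^'n" where
  "metric_tensor F x y = fundamental_matrix (F x) y"

definition geodesic_coeff ::
    "(real^'n \<Rightarrow> real^'n \<Rightarrow> real) \<Rightarrow> 'n \<Rightarrow> real^'n \<Rightarrow> real^'n \<Rightarrow> real" where
  "geodesic_coeff F i x y =
     (let F2 = (\<lambda>x y. (F x y)\<^sup>2) in
      1/4 * (\<Sum>l\<in>UNIV. matrix_inv (metric_tensor F x y) $ i $ l *
               ((\<Sum>m\<in>UNIV. pd_y l (pd_x m F2) x y * y $ m) - pd_x l F2 x y)))"

text \<open>
  Geodesics are the regular curves solving \<open>c'' + 2 G(c, c') = 0\<close>, where \<open>v\<close> is the velocity \<open>c'\<close>;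
  regularity matters because \<open>G\<close> is only defined off the zero section.
\<close>

definition geodesic ::
    "(real^'n) set \<Rightarrow> (real^'n \<Rightarrow> real^'n \<Rightarrow> real) \<Rightarrow> real set \<Rightarrow> (real \<Rightarrow> real^'n) \<Rightarrow> bool" where
  "geodesic U F J c \<longleftrightarrow>
     open J \<and> is_interval J \<and>
     (\<exists>v. \<forall>t\<in>J. c t \<in> U \<and> v t \<noteq> 0 \<and>
        (c has_vector_derivative v t) (at t) \<and>
        (v has_vector_derivative (\<chi> i. - 2 * geodesic_coeff F i (c t) (v t))) (at t))"

definition projectively_flat :: "(real^'n) set \<Rightarrow> (real^'n \<Rightarrow> real^'n \<Rightarrow> real) \<Rightarrow> bool" where
  "projectively_flat U F \<longleftrightarrow> (\<forall>J c. geodesic U F J c \<longrightarrow> collinear (c ` J))"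

definition Riemann_coeff ::
    "(real^'n \<Rightarrow> real^'n \<Rightarrow> real) \<Rightarrow> 'n \<Rightarrow> 'n \<Rightarrow> real^'n \<Rightarrow> real^'n \<Rightarrow> real" where
  "Riemann_coeff F i k x y =
     (let G = geodesic_coeff F in
      2 * pd_x k (G i) x y
      - (\<Sum>j\<in>UNIV. y $ j * pd_x j (pd_y k (G i)) x y)
      + 2 * (\<Sum>j\<in>UNIV. G j x y * pd_y j (pd_y k (G i)) x y)
      - (\<Sum>j\<in>UNIV. pd_y j (G i) x y * pd_y k (G j) x y))"

definition flag_curvature ::
    "(real^'n \<Rightarrow> real^'n \<Rightarrow> real) \<Rightarrow> real^'n \<Rightarrow> real^'n \<Rightarrow> real^'n \<Rightarrow> real" where
  "flag_curvature F x y u =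
     (let g = metric_tensor F x y in
      (\<Sum>i\<in>UNIV. \<Sum>m\<in>UNIV. \<Sum>k\<in>UNIV. g $ i $ m * Riemann_coeff F i k x y * u $ k * u $ m)
      / ((F x y)\<^sup>2 * (\<Sum>i\<in>UNIV. \<Sum>j\<in>UNIV. g $ i $ j * u $ i * u $ j)
         - (\<Sum>i\<in>UNIV. \<Sum>j\<in>UNIV. g $ i $ j * y $ i * u $ j)\<^sup>2))"

text \<open>
  The condition \<open>dim {y, u} = 2\<close> says that \<open>span {y, u}\<close> is a plane. No such plane exists in
  dimension one, where the predicate below holds vacuously.
\<close>

definition zero_flag_curvature :: "(real^'n) set \<Rightarrow> (real^'n \<Rightarrow> real^'n \<Rightarrow> real) \<Rightarrow> bool" where
  "zero_flag_curvature U F \<longleftrightarrow>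
     (\<forall>x\<in>U. \<forall>y u. dim {y, u} = 2 \<longrightarrow> flag_curvature F x y u = 0)"

text \<open>
  \<open>P\<close> lives off the zero section, because \<open>P\<close> is differentiated in \<open>y\<close> and is not smooth at \<open>y = 0\<close>;
  \<open>F x 0 = 0\<close> holds for every Finsler metric anyway.
\<close>

definition represents ::
    "(real^'n) set \<Rightarrow> (real^'n \<Rightarrow> real^'n \<Rightarrow> real) \<Rightarrow> (real^'n \<Rightarrow> real) \<Rightarrow> (real^'n \<Rightarrow> real) \<Rightarrow>
     (real^'n \<Rightarrow> real^'n \<Rightarrow> real) \<Rightarrow> bool" where
  "represents U F \<psi> \<phi> P \<longleftrightarrow>
     Minkowski_norm \<psi> \<and>
     pos_homogeneous \<phi> \<and> C_infinity_on (UNIV - {0}) \<phi> \<and>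
     C_infinity_on (slit_tangent_bundle U) (\<lambda>(x, y). P x y) \<and>
     (\<forall>x\<in>U. \<forall>y. y \<noteq> 0 \<longrightarrow>
        P x y = \<phi> (y + P x y *\<^sub>R x) \<and>
        F x y = \<psi> (y + P x y *\<^sub>R x) * (1 + (\<Sum>k\<in>UNIV. pd_y k P x y * x $ k)))"

end

theory Submission
  imports Defs
begin

text \<open>
  If the geodesics are straight, then \<open>G = P y\<close> and \<open>F\<close> satisfies Hamel's equation
  \<open>F\<^sub>x = (P F)\<^sub>y\<close>; flatness says \<open>P\<^sub>x y = P\<^sup>2\<close>, and symmetry of the second derivatives of \<open>F\<close>
  upgrades this to the Burgers type equation \<open>P\<^sub>x = P P\<^sub>y\<close>. Hence \<open>P\<close> is constant along
  \<open>x' \<mapsto> (x', y + p (x - x'))\<close> with \<open>p = P(x, y)\<close>, which at \<open>x' = 0\<close> gives \<open>P(0, y + p x) = p\<close>; on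
  the same set \<open>F\<close> and \<open>1 + P\<^sub>y x\<close> satisfy the same linear equation, so they are proportional.
  As \<open>U\<close> is only assumed connected, this is propagated not along rays but over \<open>U\<close> minus the point
  at which \<open>y + p (x - x')\<close> vanishes, a connected set because the dimension is at least two.
  Conversely, the implicit equation for \<open>P\<close> yields \<open>P\<^sub>x = P P\<^sub>y\<close> and Hamel's equation by differentiation.
\<close>

section \<open>Directional derivatives and smooth functions\<close>

text \<open>Projective flatness is a statement about curves, so extracting \<open>G = P y\<close>
  from it requires a geodesic through every nonzero vector. This is why local existence for ordinary
  differential equations and, through Cramer's rule, smoothness of \<open>G\<close> appear.

  The obstacle throughout is \<open>y = 0\<close>, where smoothness fails: before
  \<open>P(0, y + p x) = p\<close> is meaningful, \<open>y + p x \<noteq> 0\<close> has to be known.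
  In the forward direction this follows from homogeneity by letting the base point tend to the
  origin; in the converse it comes from \<open>F > 0\<close> and \<open>\<psi> 0 = 0\<close>.

  Dimension at least two has a second role: it supplies a vector orthogonal to \<open>y\<close> for
  the fundamental tensor, and on such a flag the vanishing curvature says exactly
  \<open>P\<^sub>x y = P\<^sup>2\<close>.

  The calculus is carried out for functions of pairs \<open>(x, y)\<close>, where derivatives in
  \<open>x\<close> and in \<open>y\<close> are directional derivatives of one function and commute.
  Homogeneity is mostly used as Euler's identity, because that can be differentiated.\<close>

definition dd :: "'a::real_normed_vector \<Rightarrow> ('a \<Rightarrow> real) \<Rightarrow> 'a \<Rightarrow> real" where
  "dd v f z = frechet_derivative f (at z) v"

lemma has_derivative_dd:
  assumes "f differentiable (at z)"
  shows "(f has_derivative (\<lambda>v. dd v f z)) (at z)"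
  using assms frechet_derivative_works[of f "at z"] unfolding dd_def by simp

lemma dd_eqI:
  assumes "(f has_derivative f') (at z)"
  shows "dd v f z = f' v"
  unfolding dd_def using frechet_derivative_at[OF assms] by simp

lemma dd_chain:
  assumes "f differentiable (at (g t))" "(g has_derivative g') (at t)"
  shows "((\<lambda>t. f (g t)) has_derivative (\<lambda>h. dd (g' h) f (g t))) (at t)"
  using has_derivative_compose[OF assms(2) has_derivative_dd[OF assms(1)]] .

text \<open>Both functions have the same derivatives at \<open>z\<close>, so the choice operator
  inside \<open>frechet_derivative\<close> selects the same map, even at points where neither is
  differentiable.\<close>

lemma dd_cong:
  assumes "open S" "z \<in> S" "\<And>w. w \<in> S \<Longrightarrow> f w = g w"
  shows "dd v f z = dd v g z"
proof -
  have "(f has_derivative f') (at z) \<longleftrightarrow> (g has_derivative f') (at z)" for f'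
    using assms by (metis has_derivative_transform_within_open)
  then show ?thesis
    unfolding dd_def frechet_derivative_def by simp
qed

lemma differentiable_cong:
  assumes "open S" "z \<in> S" "\<And>w. w \<in> S \<Longrightarrow> f w = g w" "f differentiable (at z)"
  shows "g differentiable (at z)"
  using assms unfolding differentiable_def by (metis has_derivative_transform_within_open)

lemma dd_const: "dd v (\<lambda>z. c) z = 0"
  by (simp add: dd_def)

lemma dd_linear:
  assumes "bounded_linear f"
  shows "dd v f z = f v"
  by (rule dd_eqI) (rule bounded_linear_imp_has_derivative[OF assms])

lemma dd_add:
  assumes "f differentiable (at z)" "g differentiable (at z)"
  shows "dd v (\<lambda>z. f z + g z) z = dd v f z + dd v g z"
  by (rule dd_eqI) (rule has_derivative_add[OF assms[THEN has_derivative_dd]])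

lemma dd_diff:
  assumes "f differentiable (at z)" "g differentiable (at z)"
  shows "dd v (\<lambda>z. f z - g z) z = dd v f z - dd v g z"
  by (rule dd_eqI) (rule has_derivative_diff[OF assms[THEN has_derivative_dd]])

lemma dd_mult:
  assumes "f differentiable (at z)" "g differentiable (at z)"
  shows "dd v (\<lambda>z. f z * g z) z = f z * dd v g z + dd v f z * g z"
  by (rule dd_eqI) (rule has_derivative_mult[OF assms[THEN has_derivative_dd]])

lemma dd_sum:
  assumes "\<And>i. i \<in> I \<Longrightarrow> f i differentiable (at z)"
  shows "dd v (\<lambda>z. \<Sum>i\<in>I. f i z) z = (\<Sum>i\<in>I. dd v (f i) z)"
  by (rule dd_eqI) (rule has_derivative_sum[OF has_derivative_dd[OF assms]])

lemma dd_inverse: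
  assumes "f differentiable (at z)" "f z \<noteq> 0"
  shows "dd v (\<lambda>z. inverse (f z)) z = - (inverse (f z) * dd v f z * inverse (f z))"
  by (rule dd_eqI) (rule Deriv.has_derivative_inverse[OF assms(2) has_derivative_dd[OF assms(1)]])

lemma linear_dd:
  assumes "f differentiable (at z)"
  shows "linear (\<lambda>v. dd v f z)"
  using has_derivative_dd[OF assms] has_derivative_linear by blast

section \<open>Closure properties of \<open>C_k_on\<close> and \<open>C_infinity_on\<close>\<close>

lemma C_k_on_Suc:
  "C_k_on (Suc k) S f \<longleftrightarrow> (\<forall>z\<in>S. f differentiable (at z)) \<and> (\<forall>v. C_k_on k S (dd v f))"
  unfolding dd_def by simp

lemma C_k_on_cong:
  assumes "open S" "\<And>z. z \<in> S \<Longrightarrow> f z = g z" "C_k_on k S f"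
  shows "C_k_on k S g"
  using assms(2,3)
proof (induction k arbitrary: f g)
  case 0
  then show ?case by (simp cong: continuous_on_cong)
next
  case (Suc k)
  have "C_k_on k S (dd v g)" for v
    using Suc.IH[of "dd v f" "dd v g"] Suc.prems dd_cong[OF \<open>open S\<close>, of _ f g]
    unfolding C_k_on_Suc by blast
  moreover have "g differentiable (at z)" if "z \<in> S" for z
    using differentiable_cong[OF \<open>open S\<close> that, of f g] Suc.prems that unfolding C_k_on_Suc by blast
  ultimately show ?case unfolding C_k_on_Suc by blast
qed

lemma C_k_on_Suc_imp:
  assumes "C_k_on (Suc k) S f"
  shows "C_k_on k S f"
  using assms
proof (induction k arbitrary: f)
  case 0
  then show ?case
    unfolding C_k_on_Suc
    by (auto intro!: continuous_at_imp_continuous_on differentiable_imp_continuous_within)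
next
  case (Suc k)
  then show ?case by (meson C_k_on_Suc)
qed

lemma C_k_on_const: "C_k_on k S (\<lambda>z. c)"
proof (induction k arbitrary: c)
  case (Suc k)
  have "dd v (\<lambda>z. c) = (\<lambda>z. 0)" for v :: 'a
    by (auto simp: dd_const)
  then show ?case using Suc unfolding C_k_on_Suc by simp
qed simp

lemma C_k_on_linear:
  assumes "bounded_linear f"
  shows "C_k_on k S f"
proof (cases k)
  case 0
  then show ?thesis using assms by (simp add: linear_continuous_on)
next
  case (Suc k)
  have "dd v f = (\<lambda>z. f v)" for v
    using dd_linear[OF assms] by auto
  then show ?thesis
    unfolding Suc C_k_on_Suc using C_k_on_const bounded_linear_imp_differentiable[OF assms] by auto
qed

lemma C_k_on_add:
  assumes "open S" "C_k_on k S f" "C_k_on k S g"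
  shows "C_k_on k S (\<lambda>z. f z + g z)"
  using assms(2,3)
proof (induction k arbitrary: f g)
  case 0
  then show ?case by (simp add: continuous_on_add)
next
  case (Suc k)
  have "C_k_on k S (\<lambda>z. dd v f z + dd v g z)" for v
    using Suc unfolding C_k_on_Suc by blast
  moreover have "dd v f z + dd v g z = dd v (\<lambda>z. f z + g z) z" if "z \<in> S" for v z
    using Suc.prems that unfolding C_k_on_Suc by (simp add: dd_add)
  ultimately have "C_k_on k S (dd v (\<lambda>z. f z + g z))" for v
    using C_k_on_cong[OF \<open>open S\<close>, of "\<lambda>z. dd v f z + dd v g z" "dd v (\<lambda>z. f z + g z)" k] by blast
  then show ?case
    using Suc.prems unfolding C_k_on_Suc by (auto intro: differentiable_add)
qed

text \<open>The product rule pairs an undifferentiated factor with a differentiated one.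
  \<open>C_k_on_Suc_imp\<close> lowers the former to the same order, and both functions must vary in
  the induction.\<close>

lemma C_k_on_mult:
  assumes "open S" "C_k_on k S f" "C_k_on k S g"
  shows "C_k_on k S (\<lambda>z. f z * g z)"
  using assms(2,3)
proof (induction k arbitrary: f g)
  case 0
  then show ?case by (simp add: continuous_on_mult)
next
  case (Suc k)
  have "C_k_on k S (\<lambda>z. f z * dd v g z + dd v f z * g z)" for v
    using Suc C_k_on_Suc_imp unfolding C_k_on_Suc
    by (intro C_k_on_add[OF \<open>open S\<close>] Suc.IH) (use Suc.prems C_k_on_Suc_imp C_k_on_Suc in blast)+
  moreover have "f z * dd v g z + dd v f z * g z = dd v (\<lambda>z. f z * g z) z" if "z \<in> S" for v z
    using Suc.prems that unfolding C_k_on_Suc by (simp add: dd_mult)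
  ultimately have "C_k_on k S (dd v (\<lambda>z. f z * g z))" for v
    using C_k_on_cong[OF \<open>open S\<close>, of "\<lambda>z. f z * dd v g z + dd v f z * g z" "dd v (\<lambda>z. f z * g z)" k] by blast
  then show ?case
    using Suc.prems unfolding C_k_on_Suc by (auto intro: differentiable_mult)
qed

text \<open>The derivative of \<open>1/f\<close> is built from \<open>1/f\<close> and a derivative
  of \<open>f\<close>, so the induction hypothesis for the same \<open>f\<close> feeds into the
  product rule.\<close>

lemma C_k_on_inverse:
  assumes "open S" "C_k_on k S f" "\<And>z. z \<in> S \<Longrightarrow> f z \<noteq> 0"
  shows "C_k_on k S (\<lambda>z. inverse (f z))"
  using assms(2)
proof (induction k)
  case 0
  then show ?case using assms(3) by (simp add: continuous_on_inverse)
next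
  case (Suc k)
  have inv: "C_k_on k S (\<lambda>z. inverse (f z))"
    using Suc C_k_on_Suc_imp by blast
  have "C_k_on k S (\<lambda>z. -1 * (inverse (f z) * dd v f z * inverse (f z)))" for v
    using Suc.prems inv by (intro C_k_on_mult[OF \<open>open S\<close>] C_k_on_const) (use C_k_on_Suc in blast)+
  moreover have "-1 * (inverse (f z) * dd v f z * inverse (f z)) = dd v (\<lambda>z. inverse (f z)) z"
    if "z \<in> S" for v z
    using Suc.prems that assms(3) unfolding C_k_on_Suc by (simp add: dd_inverse)
  ultimately have "C_k_on k S (dd v (\<lambda>z. inverse (f z)))" for v
    using C_k_on_cong[OF \<open>open S\<close>, of "\<lambda>z. -1 * (inverse (f z) * dd v f z * inverse (f z))"
        "dd v (\<lambda>z. inverse (f z))" k] by blast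
  moreover have "(\<lambda>z. inverse (f z)) differentiable (at z)" if "z \<in> S" for z
    using Suc.prems that assms(3) unfolding C_k_on_Suc by (auto intro: differentiable_inverse)
  ultimately show ?case
    unfolding C_k_on_Suc by blast
qed

text \<open>A derivative of \<open>f (c + L z)\<close> in direction \<open>v\<close> is
  \<open>dd (L v) f (c + L z)\<close>, again of the same form with a constant direction, so the
  induction closes without a chain rule of higher order. It serves for restriction to a ball and to
  the fibre over the origin.\<close>

lemma C_k_on_affine:
  assumes "open S" "open T" "bounded_linear L" "\<And>z. z \<in> T \<Longrightarrow> c + L z \<in> S" "C_k_on k S f"
  shows "C_k_on k T (\<lambda>z. f (c + L z))"
  using assms(5)
proof (induction k arbitrary: f)
  case 0
  have "continuous_on T (\<lambda>z. c + L z)"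
    using assms(3) by (intro continuous_intros linear_continuous_on)
  then show ?case
    using 0 assms(4) by (auto intro: continuous_on_compose2)
next
  case (Suc k)
  have der: "((\<lambda>z. f (c + L z)) has_derivative (\<lambda>h. dd (L h) f (c + L z))) (at z)" if "z \<in> T" for z
  proof (rule dd_chain)
    show "f differentiable (at (c + L z))"
      using Suc.prems assms(4) that unfolding C_k_on_Suc by blast
    show "((\<lambda>z. c + L z) has_derivative L) (at z)"
      using bounded_linear_imp_has_derivative[OF assms(3), of "at z"]
      by (auto intro!: derivative_eq_intros)
  qed
  have "C_k_on k T (\<lambda>z. dd (L v) f (c + L z))" for v
    using Suc unfolding C_k_on_Suc by blast
  then have "C_k_on k T (dd v (\<lambda>z. f (c + L z)))" for v
    by (rule C_k_on_cong[OF \<open>open T\<close>, rotated]) (simp add: dd_eqI[OF der])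
  then show ?case
    using der unfolding C_k_on_Suc differentiable_def by blast
qed

lemma C_infinity_on_dd:
  "C_infinity_on S f \<Longrightarrow> C_infinity_on S (dd v f)"
  unfolding C_infinity_on_def using C_k_on_Suc by blast

lemma C_infinity_on_differentiable:
  "C_infinity_on S f \<Longrightarrow> z \<in> S \<Longrightarrow> f differentiable (at z)"
  unfolding C_infinity_on_def using C_k_on_Suc by blast

lemma C_infinity_on_continuous_on:
  "C_infinity_on S f \<Longrightarrow> continuous_on S f"
  unfolding C_infinity_on_def using C_k_on.simps(1) by blast

lemma C_infinity_on_cong:
  "open S \<Longrightarrow> (\<And>z. z \<in> S \<Longrightarrow> f z = g z) \<Longrightarrow> C_infinity_on S f \<Longrightarrow> C_infinity_on S g"
  unfolding C_infinity_on_def using C_k_on_cong by blast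

lemma C_infinity_on_const: "C_infinity_on S (\<lambda>z. c)"
  unfolding C_infinity_on_def using C_k_on_const by blast

lemma C_infinity_on_linear: "bounded_linear f \<Longrightarrow> C_infinity_on S f"
  unfolding C_infinity_on_def using C_k_on_linear by blast

lemma C_infinity_on_add:
  "open S \<Longrightarrow> C_infinity_on S f \<Longrightarrow> C_infinity_on S g \<Longrightarrow> C_infinity_on S (\<lambda>z. f z + g z)"
  unfolding C_infinity_on_def using C_k_on_add by blast

lemma C_infinity_on_mult:
  "open S \<Longrightarrow> C_infinity_on S f \<Longrightarrow> C_infinity_on S g \<Longrightarrow> C_infinity_on S (\<lambda>z. f z * g z)"
  unfolding C_infinity_on_def using C_k_on_mult by blast

lemma C_infinity_on_diff:
  assumes "open S" "C_infinity_on S f" "C_infinity_on S g"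
  shows "C_infinity_on S (\<lambda>z. f z - g z)"
  using C_infinity_on_add[OF assms(1,2) C_infinity_on_mult[OF assms(1) C_infinity_on_const assms(3)], of "-1"]
  by simp

lemma C_infinity_on_divide:
  assumes "open S" "C_infinity_on S f" "C_infinity_on S g" "\<And>z. z \<in> S \<Longrightarrow> g z \<noteq> 0"
  shows "C_infinity_on S (\<lambda>z. f z / g z)"
proof -
  have "C_infinity_on S (\<lambda>z. inverse (g z))"
    using assms C_k_on_inverse unfolding C_infinity_on_def by blast
  then show ?thesis
    unfolding divide_inverse using C_infinity_on_mult assms by blast
qed

lemma C_infinity_on_sum:
  assumes "open S" "\<And>i. i \<in> I \<Longrightarrow> C_infinity_on S (f i)"
  shows "C_infinity_on S (\<lambda>z. \<Sum>i\<in>I. f i z)"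
  using assms(2)
  by (induction I rule: infinite_finite_induct)
    (simp_all add: C_infinity_on_const C_infinity_on_add[OF \<open>open S\<close>])

lemma C_infinity_on_prod:
  assumes "open S" "\<And>i. i \<in> I \<Longrightarrow> C_infinity_on S (f i)"
  shows "C_infinity_on S (\<lambda>z. \<Prod>i\<in>I. f i z)"
  using assms(2)
  by (induction I rule: infinite_finite_induct)
    (simp_all add: C_infinity_on_const C_infinity_on_mult[OF \<open>open S\<close>])

lemma C_infinity_on_affine:
  assumes "open S" "open T" "bounded_linear L" "\<And>z. z \<in> T \<Longrightarrow> c + L z \<in> S" "C_infinity_on S f"
  shows "C_infinity_on T (\<lambda>z. f (c + L z))"
  using assms C_k_on_affine unfolding C_infinity_on_def by blast

lemma C_infinity_on_det:
  fixes A :: "'a::euclidean_space \<Rightarrow> real^'n^'n"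
  assumes "open S" "\<And>i j. C_infinity_on S (\<lambda>z. A z $ i $ j)"
  shows "C_infinity_on S (\<lambda>z. det (A z))"
  unfolding det_def using assms
  by (intro C_infinity_on_sum C_infinity_on_mult C_infinity_on_prod C_infinity_on_const) auto

section \<open>Symmetry of second derivatives\<close>

text \<open>The mean value theorem is applied twice: in direction \<open>u\<close> to the difference
  over \<open>v\<close>, then in direction \<open>v\<close> to the derivative along
  \<open>u\<close>. The left-hand side is symmetric in \<open>u\<close> and \<open>v\<close>, which
  is what \<open>dd_commute\<close> exploits.\<close>

lemma second_difference_mean_value:
  fixes f :: "'a::euclidean_space \<Rightarrow> real"
  assumes f: "C_infinity_on (ball z r) f" and t: "0 < t" "t * (norm u + norm v) < r"
  shows "\<exists>p. norm (p - z) \<le> t * (norm u + norm v) \<and>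
      f (z + t *\<^sub>R u + t *\<^sub>R v) - f (z + t *\<^sub>R u) - f (z + t *\<^sub>R v) + f z = t\<^sup>2 * dd v (dd u f) p"
proof -
  have near: "norm (a *\<^sub>R u + b *\<^sub>R v) \<le> t * (norm u + norm v)"
    if "0 \<le> a" "a \<le> t" "0 \<le> b" "b \<le> t" for a b
  proof -
    have "norm (a *\<^sub>R u + b *\<^sub>R v) \<le> a * norm u + b * norm v"
      using norm_triangle_ineq[of "a *\<^sub>R u" "b *\<^sub>R v"] that by simp
    also have "\<dots> \<le> t * norm u + t * norm v"
      using that by (intro add_mono mult_right_mono) auto
    finally show ?thesis by (simp add: algebra_simps)
  qed
  have inb: "z + a *\<^sub>R u + b *\<^sub>R v \<in> ball z r" if "0 \<le> a" "a \<le> t" "0 \<le> b" "b \<le> t" for a b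
  proof -
    have "dist z (z + (a *\<^sub>R u + b *\<^sub>R v)) = norm (a *\<^sub>R u + b *\<^sub>R v)"
      by (simp add: dist_norm del: minus_add_distrib flip: norm_minus_commute)
    then show ?thesis using near[OF that] t(2) by (simp add: add.assoc)
  qed
  have du: "((\<lambda>s. g (z + s *\<^sub>R u + b *\<^sub>R v)) has_derivative
      (\<lambda>h. h * dd u g (z + a *\<^sub>R u + b *\<^sub>R v))) (at a)"
    if "C_infinity_on (ball z r) g" "0 \<le> a" "a \<le> t" "0 \<le> b" "b \<le> t" for g a b
  proof -
    have d: "g differentiable (at (z + a *\<^sub>R u + b *\<^sub>R v))"
      using C_infinity_on_differentiable inb that by blast
    have "((\<lambda>s. z + s *\<^sub>R u + b *\<^sub>R v) has_derivative (\<lambda>h. h *\<^sub>R u)) (at a)"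
      by (auto intro!: derivative_eq_intros)
    from dd_chain[of g "\<lambda>s. z + s *\<^sub>R u + b *\<^sub>R v", OF d this] show ?thesis
      using linear_scale[OF linear_dd[OF d]] by simp
  qed
  have dv: "((\<lambda>s. g (z + a *\<^sub>R u + s *\<^sub>R v)) has_derivative
      (\<lambda>h. h * dd v g (z + a *\<^sub>R u + b *\<^sub>R v))) (at b)"
    if "C_infinity_on (ball z r) g" "0 \<le> a" "a \<le> t" "0 \<le> b" "b \<le> t" for g a b
  proof -
    have d: "g differentiable (at (z + a *\<^sub>R u + b *\<^sub>R v))"
      using C_infinity_on_differentiable inb that by blast
    have "((\<lambda>s. z + a *\<^sub>R u + s *\<^sub>R v) has_derivative (\<lambda>h. h *\<^sub>R v)) (at b)"
      by (auto intro!: derivative_eq_intros)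
    from dd_chain[of g "\<lambda>s. z + a *\<^sub>R u + s *\<^sub>R v", OF d this] show ?thesis
      using linear_scale[OF linear_dd[OF d]] by simp
  qed
  \<comment> \<open>The zero multiple of \<open>v\<close> is kept so that \<open>du\<close> covers
    both terms, with \<open>b = t\<close> and \<open>b = 0\<close>.\<close>
  define \<phi> where "\<phi> s = f (z + s *\<^sub>R u + t *\<^sub>R v) - f (z + s *\<^sub>R u + 0 *\<^sub>R v)" for s
  have d\<phi>: "(\<phi> has_derivative
      (\<lambda>h. h * dd u f (z + x *\<^sub>R u + t *\<^sub>R v) - h * dd u f (z + x *\<^sub>R u + 0 *\<^sub>R v)))
      (at x within {0..t})" if "0 \<le> x" "x \<le> t" for x
    unfolding \<phi>_def
    by (rule has_derivative_at_withinI[OF has_derivative_diff[OF du[OF f that] du[OF f that]]])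
      (use t in auto)
  obtain \<xi> where \<xi>: "0 < \<xi>" "\<xi> < t" and e1:
      "\<phi> t - \<phi> 0 = t * (dd u f (z + \<xi> *\<^sub>R u + t *\<^sub>R v) - dd u f (z + \<xi> *\<^sub>R u + 0 *\<^sub>R v))"
    using mvt_simple[OF t(1) d\<phi>] by (auto simp: algebra_simps)
  define \<theta> where "\<theta> s = dd u f (z + \<xi> *\<^sub>R u + s *\<^sub>R v)" for s
  have d\<theta>: "(\<theta> has_derivative (\<lambda>h. h * dd v (dd u f) (z + \<xi> *\<^sub>R u + x *\<^sub>R v))) (at x within {0..t})"
    if "0 \<le> x" "x \<le> t" for x
    unfolding \<theta>_def
    by (rule has_derivative_at_withinI[OF dv[OF C_infinity_on_dd[OF f] _ _ that]]) (use \<xi> in auto)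
  obtain \<eta> where \<eta>: "0 < \<eta>" "\<eta> < t" and e2:
      "dd u f (z + \<xi> *\<^sub>R u + t *\<^sub>R v) - dd u f (z + \<xi> *\<^sub>R u + 0 *\<^sub>R v) =
      t * dd v (dd u f) (z + \<xi> *\<^sub>R u + \<eta> *\<^sub>R v)"
    using mvt_simple[OF t(1) d\<theta>] unfolding \<theta>_def by auto
  show ?thesis
  proof (intro exI conjI)
    show "norm ((z + \<xi> *\<^sub>R u + \<eta> *\<^sub>R v) - z) \<le> t * (norm u + norm v)"
      using near[of \<xi> \<eta>] \<xi> \<eta> by (simp add: algebra_simps)
    show "f (z + t *\<^sub>R u + t *\<^sub>R v) - f (z + t *\<^sub>R u) - f (z + t *\<^sub>R v) + f z =
        t\<^sup>2 * dd v (dd u f) (z + \<xi> *\<^sub>R u + \<eta> *\<^sub>R v)"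
      using e1 e2 unfolding \<phi>_def by (simp add: power2_eq_square)
  qed
qed

text \<open>One second difference equals \<open>t\<^sup>2\<close> times either mixed derivative,
  each taken at some point near \<open>z\<close>. Continuity of both mixed derivatives then rules
  out different values at \<open>z\<close>.\<close>

lemma dd_commute:
  fixes f :: "'a::euclidean_space \<Rightarrow> real"
  assumes "open S" "z \<in> S" "C_infinity_on S f"
  shows "dd u (dd v f) z = dd v (dd u f) z"
proof (rule ccontr)
  assume ne: "dd u (dd v f) z \<noteq> dd v (dd u f) z"
  \<comment> \<open>Half the distance: a common value within \<open>e\<close> of both numbers would
    contradict the triangle inequality.\<close>
  define e where "e = dist (dd u (dd v f) z) (dd v (dd u f) z) / 2"
  have e: "e > 0" using ne by (simp add: e_def)
  obtain r where r: "r > 0" "ball z r \<subseteq> S"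
    using assms openE by blast
  have f: "C_infinity_on (ball z r) f"
  proof -
    have "C_infinity_on (ball z r) (\<lambda>w. f (0 + w))"
      by (rule C_infinity_on_affine[OF assms(1) _ bounded_linear_ident]) (use r assms in auto)
    then show ?thesis by simp
  qed
  have near: "\<exists>d>0. \<forall>w. dist w z < d \<longrightarrow> dist (dd a (dd b f) w) (dd a (dd b f) z) < e" for a b
  proof -
    have "continuous (at z) (dd a (dd b f))"
      using C_infinity_on_differentiable[OF C_infinity_on_dd[OF C_infinity_on_dd[OF assms(3)]] assms(2)]
      by (rule differentiable_imp_continuous_within)
    then show ?thesis using e unfolding continuous_at_eps_delta by blast
  qed
  obtain d1 where d1: "d1 > 0" "\<And>w. dist w z < d1 \<Longrightarrow> dist (dd u (dd v f) w) (dd u (dd v f) z) < e"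
    using near by blast
  obtain d2 where d2: "d2 > 0" "\<And>w. dist w z < d2 \<Longrightarrow> dist (dd v (dd u f) w) (dd v (dd u f) z) < e"
    using near by blast
  define m where "m = min r (min d1 d2)"
  \<comment> \<open>The summand 1 makes the quotient meaningful for \<open>u = v = 0\<close> and the
    bound by \<open>m\<close> strict.\<close>
  define t where "t = m / (norm u + norm v + 1)"
  have m: "m > 0" using r d1 d2 by (simp add: m_def)
  have pos: "norm u + norm v + 1 > 0" by (simp add: add_nonneg_pos)
  have t: "t > 0" using m pos by (simp add: t_def)
  have "t * (norm u + norm v) < t * (norm u + norm v + 1)"
    using t by (intro mult_strict_left_mono) auto
  also have "\<dots> = m" using pos by (simp add: t_def)
  finally have tm: "t * (norm u + norm v) < m" .
  obtain p where p: "norm (p - z) \<le> t * (norm u + norm v)"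
    "f (z + t *\<^sub>R u + t *\<^sub>R v) - f (z + t *\<^sub>R u) - f (z + t *\<^sub>R v) + f z = t\<^sup>2 * dd v (dd u f) p"
    using second_difference_mean_value[OF f t, of u v] tm by (auto simp: m_def)
  obtain q where q: "norm (q - z) \<le> t * (norm v + norm u)"
    "f (z + t *\<^sub>R v + t *\<^sub>R u) - f (z + t *\<^sub>R v) - f (z + t *\<^sub>R u) + f z = t\<^sup>2 * dd u (dd v f) q"
    using second_difference_mean_value[OF f t, of v u] tm by (auto simp: m_def add.commute)
  have "t\<^sup>2 * dd v (dd u f) p = t\<^sup>2 * dd u (dd v f) q"
    using p(2) q(2) by (simp add: algebra_simps)
  then have eq: "dd v (dd u f) p = dd u (dd v f) q" using t by simp
  have "dist (dd v (dd u f) p) (dd v (dd u f) z) < e"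
    using d2(2)[of p] p(1) tm by (simp add: m_def dist_norm)
  moreover have "dist (dd u (dd v f) q) (dd u (dd v f) z) < e"
    using d1(2)[of q] q(1) tm by (simp add: m_def dist_norm add.commute)
  ultimately show False
    unfolding eq e_def using dist_triangle2 by (smt (verit) dist_commute field_sum_of_halves)
qed

section \<open>Linear first order systems\<close>

text \<open>On a ball of radius \<open>r\<close> on which \<open>K r \<le> 1/2\<close>, the maximum \<open>m\<close> of \<open>\<bar>g\<bar>\<close> satisfies
  \<open>m \<le> m / 2\<close>, so the zero set of \<open>g\<close> is open.\<close>

lemma zero_if_derivative_bounded_by_self:
  fixes g :: "'a::euclidean_space \<Rightarrow> real"
  assumes U: "open U" "connected U" "x0 \<in> U" "g x0 = 0"
    and der: "\<And>x. x \<in> U \<Longrightarrow> (g has_derivative g' x) (at x)"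
    and bound: "\<And>x v. x \<in> U \<Longrightarrow> \<bar>g' x v\<bar> \<le> K x * \<bar>g x\<bar> * norm v"
    and K: "continuous_on U K"
    and x: "x \<in> U"
  shows "g x = 0"
proof -
  have contg: "continuous_on U g"
    using der has_derivative_continuous continuous_at_imp_continuous_on by blast
  define Z where "Z = {x \<in> U. g x = 0}"
  have "openin (top_of_set U) Z"
    unfolding openin_contains_ball
  proof (intro conjI ballI)
    fix a assume "a \<in> Z"
    then have a: "a \<in> U" "g a = 0" by (auto simp: Z_def)
    obtain r where r: "r > 0" "cball a r \<subseteq> U"
      using U(1) a(1) open_contains_cball by blast
    have "bounded (K ` cball a r)"
      using K r continuous_on_subset compact_continuous_image compact_imp_bounded compact_cball by metis
    then obtain M where M: "M > 0" "\<And>z. z \<in> cball a r \<Longrightarrow> \<bar>K z\<bar> \<le> M"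
      unfolding bounded_pos by (metis imageI real_norm_def)
    define s where "s = min r (1 / (2 * M))"
    have s: "s > 0" "s \<le> r" "M * s \<le> 1 / 2"
    proof -
      show "s > 0" "s \<le> r" using r M by (auto simp: s_def)
      have "M * s \<le> M * (1 / (2 * M))" using M by (intro mult_left_mono) (auto simp: s_def)
      then show "M * s \<le> 1 / 2" using M by simp
    qed
    have sub: "cball a s \<subseteq> U" using r s by auto
    have "continuous_on (cball a s) (\<lambda>z. \<bar>g z\<bar>)"
      using contg sub continuous_on_subset by (intro continuous_intros) blast
    then obtain w where w: "w \<in> cball a s" "\<And>z. z \<in> cball a s \<Longrightarrow> \<bar>g z\<bar> \<le> \<bar>g w\<bar>"
      using continuous_attains_sup[of "cball a s" "\<lambda>z. \<bar>g z\<bar>"] s(1) by auto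
    have "norm (g w - g a) \<le> (M * \<bar>g w\<bar>) * norm (w - a)"
    proof (rule differentiable_bound[OF convex_cball[of a s]])
      fix z assume z: "z \<in> cball a s"
      show "(g has_derivative g' z) (at z within cball a s)"
        using der sub z has_derivative_at_withinI by blast
      show "onorm (g' z) \<le> M * \<bar>g w\<bar>"
      proof (rule onorm_le)
        fix v :: 'a
        have "K z * \<bar>g z\<bar> * norm v \<le> M * \<bar>g w\<bar> * norm v"
        proof (intro mult_right_mono mult_mono)
          show "K z \<le> M" using M(2)[of z] z s by auto
        qed (use w(2) z M in auto)
        then show "norm (g' z v) \<le> M * \<bar>g w\<bar> * norm v"
          using bound[of z v] z sub by auto
      qed
    qed (use w s in auto)
    also have "\<dots> \<le> (M * \<bar>g w\<bar>) * s"
      using w M by (intro mult_left_mono) (auto simp: dist_norm norm_minus_commute)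
    also have "\<dots> = (M * s) * \<bar>g w\<bar>" by simp
    also have "\<dots> \<le> 1 / 2 * \<bar>g w\<bar>" using s by (intro mult_right_mono) auto
    finally have "g w = 0" using a by simp
    then have "g z = 0" if "z \<in> cball a s" for z using w(2)[OF that] by simp
    then show "\<exists>e>0. ball a e \<inter> U \<subseteq> Z"
      using s(1) by (intro exI[of _ s]) (auto simp: Z_def)
  qed (auto simp: Z_def)
  moreover have "closedin (top_of_set U) Z"
    unfolding Z_def using continuous_closedin_preimage_constant[OF contg] .
  ultimately have "Z = {} \<or> Z = U"
    using U(2) unfolding connected_clopen by blast
  then show ?thesis using U x by (auto simp: Z_def)
qed

section \<open>Local existence for ordinary differential equations\<close>

text \<open>Picard's integral operator is a contraction on the complete space of bounded continuous
  functions on the line. To stay in that space, the integral is evaluated at the time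
  \<open>cl t\<close>, clamped to \<open>{-h..h}\<close>; only times in this interval matter in the
  end.\<close>

lemma flow_exists_lipschitz:
  fixes X :: "'a::euclidean_space \<Rightarrow> 'a"
  assumes lip: "\<And>a b. norm (X a - X b) \<le> L * norm (a - b)" and L: "0 \<le> L"
  shows "\<exists>h>0. \<exists>z. z 0 = z0 \<and> (\<forall>t\<in>{-h<..<h}. (z has_vector_derivative X (z t)) (at t))"
proof -
  \<comment> \<open>With integrals of length at most \<open>2 * h\<close>, each changes by at most a
    quarter of \<open>dist f g\<close>. Two of them occur in \<open>G\<close>, which gives the
    contraction constant 1/2.\<close>
  define h where "h = 1 / (8 * L + 8)"
  have h: "h > 0" "L * (2 * h) \<le> 1 / 4"
    using L by (simp_all add: h_def field_simps)
  have contX: "continuous_on UNIV X"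
  proof -
    have "L-lipschitz_on UNIV X"
      using lip L by (intro lipschitz_onI) (auto simp: dist_norm)
    then show ?thesis by (rule lipschitz_on_continuous_on)
  qed
  have contXf: "continuous_on I (\<lambda>s. X (apply_bcontfun f s))" for f and I :: "real set"
    by (rule continuous_on_compose2[OF contX]) auto
  have intXf: "(\<lambda>s. X (apply_bcontfun f s)) integrable_on {a..b}" for f and a b :: real
    by (rule integrable_continuous_real[OF contXf])
  define cl where "cl t = max (- h) (min h t)" for t :: real
  have cl: "cl t \<in> {-h..h}" for t using h by (auto simp: cl_def)
  \<comment> \<open>The integral from 0 to \<open>u\<close> is a difference of integrals from
    \<open>-h\<close>, because the integral over \<open>{0..u}\<close> would be zero for negative
    \<open>u\<close>.\<close>
  define G where "G f u = z0 + integral {-h..u} (\<lambda>s. X (apply_bcontfun f s))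
      - integral {-h..0} (\<lambda>s. X (apply_bcontfun f s))" for f u
  have contG: "continuous_on {-h..h} (G f)" for f
    unfolding G_def by (intro continuous_intros indefinite_integral_continuous_1 intXf)
  have bc: "(\<lambda>t. G f (cl t)) \<in> bcontfun" for f
  proof -
    have "continuous_on UNIV cl"
      unfolding cl_def by (intro continuous_intros)
    then have "continuous_on UNIV (\<lambda>t. G f (cl t))"
      using cl by (intro continuous_on_compose2[OF contG]) auto
    moreover have "bounded (range (\<lambda>t. G f (cl t)))"
    proof (rule bounded_subset)
      show "bounded (G f ` {-h..h})"
        by (rule compact_imp_bounded[OF compact_continuous_image[OF contG compact_Icc]])
    qed (use cl in auto)
    ultimately show ?thesis by (simp add: bcontfun_def)
  qed
  define T where "T f = Bcontfun (\<lambda>t. G f (cl t))" for f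
  have T: "apply_bcontfun (T f) t = G f (cl t)" for f t
    unfolding T_def using Bcontfun_inverse[OF bc] by simp
  have bd: "norm (integral {-h..u} (\<lambda>s. X (apply_bcontfun f s)) - integral {-h..u} (\<lambda>s. X (apply_bcontfun g s)))
      \<le> 1 / 4 * dist f g" if u: "u \<in> {-h..h}" for f g u
  proof -
    have "norm (integral {-h..u} (\<lambda>s. X (apply_bcontfun f s) - X (apply_bcontfun g s)))
        \<le> (L * dist f g) * (u - (- h))"
    proof (rule integral_bound)
      show "continuous_on {-h..u} (\<lambda>s. X (apply_bcontfun f s) - X (apply_bcontfun g s))"
        by (intro continuous_intros contXf)
      fix s
      have "norm (X (apply_bcontfun f s) - X (apply_bcontfun g s)) \<le> L * dist (apply_bcontfun f s) (apply_bcontfun g s)"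
        using lip by (simp add: dist_norm)
      also have "\<dots> \<le> L * dist f g"
        by (rule mult_left_mono[OF dist_bounded L])
      finally show "norm (X (apply_bcontfun f s) - X (apply_bcontfun g s)) \<le> L * dist f g" .
    qed (use u in auto)
    also have "\<dots> \<le> (L * dist f g) * (2 * h)"
      using u L by (intro mult_left_mono) auto
    also have "\<dots> = (L * (2 * h)) * dist f g" by simp
    also have "\<dots> \<le> 1 / 4 * dist f g"
      using h by (intro mult_right_mono) auto
    finally show ?thesis by (simp add: integral_diff[OF intXf intXf])
  qed
  have "dist (T f) (T g) \<le> 1 / 2 * dist f g" for f g
  proof (rule dist_bound)
    fix t
    have "dist (apply_bcontfun (T f) t) (apply_bcontfun (T g) t) \<le>
      norm (integral {-h..cl t} (\<lambda>s. X (apply_bcontfun f s)) - integral {-h..cl t} (\<lambda>s. X (apply_bcontfun g s)))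
      + norm (integral {-h..0} (\<lambda>s. X (apply_bcontfun f s)) - integral {-h..0} (\<lambda>s. X (apply_bcontfun g s)))"
      unfolding T G_def dist_norm by (rule order_trans[OF _ norm_triangle_ineq4]) (simp add: algebra_simps)
    also have "\<dots> \<le> 1 / 4 * dist f g + 1 / 4 * dist f g"
      using cl h by (intro add_mono bd) auto
    finally show "dist (apply_bcontfun (T f) t) (apply_bcontfun (T g) t) \<le> 1 / 2 * dist f g" by simp
  qed
  then obtain f where f: "T f = f"
    using banach_fix_type[of "1 / 2" T] by auto
  have sol: "apply_bcontfun f t = G f t" if "t \<in> {-h..h}" for t
    using T[of f t] that unfolding f by (simp add: cl_def)
  show ?thesis
  proof (intro exI[of _ h] exI[of _ "apply_bcontfun f"] conjI ballI)
    show "apply_bcontfun f 0 = z0" using sol[of 0] h by (simp add: G_def)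
    fix t assume t: "t \<in> {-h<..<h}"
    have "((\<lambda>u. integral {-h..u} (\<lambda>s. X (apply_bcontfun f s))) has_vector_derivative X (apply_bcontfun f t)) (at t within {-h..h})"
      using t by (intro integral_has_vector_derivative contXf) auto
    then have "((\<lambda>u. integral {-h..u} (\<lambda>s. X (apply_bcontfun f s))) has_vector_derivative X (apply_bcontfun f t)) (at t)"
      using t by (subst (asm) at_within_Icc_at) auto
    then have "(G f has_vector_derivative X (apply_bcontfun f t)) (at t)"
      unfolding G_def[abs_def]
      by (intro has_vector_derivative_diff[OF has_vector_derivative_add[OF has_vector_derivative_const]
          has_vector_derivative_const, THEN has_vector_derivative_eq_rhs]) simp_all
    then show "(apply_bcontfun f has_vector_derivative X (apply_bcontfun f t)) (at t)"
      by (rule has_vector_derivative_transform_within_open[OF _ open_greaterThanLessThan t])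
        (rule sol[symmetric], auto)
  qed (use h in auto)
qed

text \<open>The sum of the absolute partial derivatives dominates the operator norm and is
  continuous, hence bounded on the compact ball; convexity of the ball turns this into a Lipschitz
  bound.\<close>

lemma C_infinity_on_lipschitz_cball:
  fixes f :: "'a::euclidean_space \<Rightarrow> real"
  assumes "C_infinity_on S f" "cball z0 r \<subseteq> S"
  shows "\<exists>B\<ge>0. \<forall>a\<in>cball z0 r. \<forall>b\<in>cball z0 r. \<bar>f a - f b\<bar> \<le> B * norm (a - b)"
proof -
  have "continuous_on (cball z0 r) (\<lambda>z. \<Sum>b\<in>Basis. \<bar>dd b f z\<bar>)"
    using assms C_infinity_on_continuous_on[OF C_infinity_on_dd[OF assms(1)]] continuous_on_subset
    by (intro continuous_intros) blast
  then have "bounded ((\<lambda>z. \<Sum>b\<in>Basis. \<bar>dd b f z\<bar>) ` cball z0 r)"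
    using compact_continuous_image compact_imp_bounded compact_cball by blast
  then obtain B where B: "B > 0" "\<And>z. z \<in> cball z0 r \<Longrightarrow> (\<Sum>b\<in>Basis. \<bar>dd b f z\<bar>) \<le> B"
    unfolding bounded_pos by (metis abs_le_D1 imageI real_norm_def)
  have "norm (f a - f b) \<le> B * norm (a - b)" if "a \<in> cball z0 r" "b \<in> cball z0 r" for a b
  proof (rule differentiable_bound[OF convex_cball[of z0 r] _ _ that])
    fix z assume z: "z \<in> cball z0 r"
    have d: "f differentiable (at z)"
      using C_infinity_on_differentiable assms z by blast
    then show "(f has_derivative (\<lambda>v. dd v f z)) (at z within cball z0 r)"
      using has_derivative_dd has_derivative_at_withinI by blast
    show "onorm (\<lambda>v. dd v f z) \<le> B"
    proof (rule onorm_le)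
      fix v :: 'a
      have "dd v f z = dd (\<Sum>b\<in>Basis. (v \<bullet> b) *\<^sub>R b) f z"
        by (simp add: euclidean_representation)
      also have "\<dots> = (\<Sum>b\<in>Basis. (v \<bullet> b) * dd b f z)"
        by (simp add: linear_sum[OF linear_dd[OF d]] linear_scale[OF linear_dd[OF d]])
      also have "\<bar>\<dots>\<bar> \<le> (\<Sum>b\<in>Basis. norm v * \<bar>dd b f z\<bar>)"
        by (rule order_trans[OF sum_abs sum_mono]) (simp add: abs_mult Basis_le_norm mult_right_mono)
      also have "\<dots> \<le> B * norm v"
        using mult_left_mono[OF B(2)[OF z], of "norm v"] by (simp add: sum_distrib_left mult.commute)
      finally show "norm (dd v f z) \<le> B * norm v" by simp
    qed
  qed
  then show ?thesis using B by (intro exI[of _ B]) auto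
qed

text \<open>Precomposing \<open>X\<close> with the closest point projection \<open>c\<close> onto a
  small ball, which does not increase distances, makes it globally Lipschitz. For short times the
  solution remains in the ball, where \<open>c\<close> is the identity.\<close>

lemma flow_exists:
  fixes X :: "'a::euclidean_space \<Rightarrow> 'a"
  assumes "open S" "z0 \<in> S" "\<And>b. b \<in> Basis \<Longrightarrow> C_infinity_on S (\<lambda>z. X z \<bullet> b)"
  shows "\<exists>h>0. \<exists>z. z 0 = z0 \<and>
    (\<forall>t\<in>{-h<..<h}. z t \<in> S \<and> (z has_vector_derivative X (z t)) (at t))"
proof -
  obtain r where r: "r > 0" "cball z0 r \<subseteq> S"
    using assms(1,2) open_contains_cball by blast
  have "\<exists>B. \<forall>b\<in>Basis. B b \<ge> 0 \<and>
      (\<forall>u\<in>cball z0 r. \<forall>w\<in>cball z0 r. \<bar>X u \<bullet> b - X w \<bullet> b\<bar> \<le> B b * norm (u - w))"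
    using C_infinity_on_lipschitz_cball[OF assms(3) r(2)] by (intro bchoice) blast
  then obtain B where B: "\<And>b. b \<in> Basis \<Longrightarrow> B b \<ge> 0"
    "\<And>b u w. b \<in> Basis \<Longrightarrow> u \<in> cball z0 r \<Longrightarrow> w \<in> cball z0 r \<Longrightarrow>
      \<bar>X u \<bullet> b - X w \<bullet> b\<bar> \<le> B b * norm (u - w)" by metis
  define L where "L = (\<Sum>b\<in>Basis. B b)"
  have L: "L \<ge> 0" unfolding L_def by (intro sum_nonneg B)
  have lip: "norm (X u - X w) \<le> L * norm (u - w)" if "u \<in> cball z0 r" "w \<in> cball z0 r" for u w
  proof -
    have "norm (X u - X w) \<le> (\<Sum>b\<in>Basis. \<bar>(X u - X w) \<bullet> b\<bar>)" by (rule norm_le_l1)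
    also have "\<dots> \<le> (\<Sum>b\<in>Basis. B b * norm (u - w))"
      using B(2) that by (intro sum_mono) (simp add: inner_diff_left)
    finally show ?thesis by (simp add: L_def sum_distrib_right)
  qed
  define c where "c = closest_point (cball z0 r)"
  have c: "c u \<in> cball z0 r" for u
    unfolding c_def using r by (intro closest_point_in_set) auto
  have "norm (X (c u) - X (c w)) \<le> L * norm (u - w)" for u w
  proof -
    have "dist (c u) (c w) \<le> dist u w"
      unfolding c_def using r by (intro closest_point_lipschitz) auto
    then have "L * norm (c u - c w) \<le> L * norm (u - w)"
      using L by (intro mult_left_mono) (auto simp: dist_norm)
    then show ?thesis using lip[OF c c, of u w] by simp
  qed
  from flow_exists_lipschitz[of "\<lambda>u. X (c u)", OF this L]
  obtain h z where h: "h > 0" "z 0 = z0"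
    and z: "\<And>t. t \<in> {-h<..<h} \<Longrightarrow> (z has_vector_derivative X (c (z t))) (at t)" by blast
  have "continuous (at 0) z"
    using z[of 0] h by (auto intro: has_vector_derivative_continuous)
  then obtain d where d: "d > 0" "\<And>t. dist t 0 < d \<Longrightarrow> dist (z t) (z 0) < r"
    using r(1) unfolding continuous_at_eps_delta by blast
  show ?thesis
  proof (intro exI[of _ "min h d"] exI[of _ z] conjI ballI)
    fix t assume t: "t \<in> {- min h d<..<min h d}"
    then have zt: "z t \<in> cball z0 r"
      using d(2)[of t] h t by (auto simp: dist_commute dist_real_def less_imp_le)
    then show "z t \<in> S" using r by blast
    have "c (z t) = z t" unfolding c_def by (rule closest_point_self[OF zt])
    then show "(z has_vector_derivative X (z t)) (at t)" using z[of t] t by auto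
  qed (use h d in auto)
qed

section \<open>Calculus on the slit tangent bundle\<close>

abbreviation dX :: "'n \<Rightarrow> ((real^'n) \<times> (real^'n) \<Rightarrow> real) \<Rightarrow> (real^'n) \<times> (real^'n) \<Rightarrow> real" where
  "dX k \<equiv> dd (axis k 1, 0)"

abbreviation dY :: "'n \<Rightarrow> ((real^'n) \<times> (real^'n) \<Rightarrow> real) \<Rightarrow> (real^'n) \<times> (real^'n) \<Rightarrow> real" where
  "dY k \<equiv> dd (0, axis k 1)"

lemma axis_one_nth: "axis k (1::real) $ j = (if j = k then 1 else 0)"
  by (auto simp: axis_def)

lemma sum_axis:
  fixes f :: "'n::finite \<Rightarrow> real"
  shows "(\<Sum>j\<in>UNIV. axis k 1 $ j * f j) = f k" "(\<Sum>j\<in>UNIV. f j * axis k 1 $ j) = f k"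
    "(\<Sum>j\<in>UNIV. axis j 1 $ k * f j) = f k" "(\<Sum>j\<in>UNIV. f j * axis j 1 $ k) = f k"
  by (simp_all add: axis_one_nth if_distrib[of "\<lambda>c. c * _"] if_distrib[of "(*) _"] cong: if_cong)

lemma dd_fst: "dd v (\<lambda>z. fst z $ k) z = fst v $ k"
  by (rule dd_linear[OF bounded_linear_compose[OF bounded_linear_vec_nth bounded_linear_fst]])

lemma dd_snd: "dd v (\<lambda>z. snd z $ k) z = snd v $ k"
  by (rule dd_linear[OF bounded_linear_compose[OF bounded_linear_vec_nth bounded_linear_snd]])

lemma dd_eq_sum_dY:
  assumes "f differentiable (at z)"
  shows "dd (0, v) f z = (\<Sum>j\<in>UNIV. v $ j * dY j f z)"
proof -
  have "(0, v) = (\<Sum>j\<in>UNIV. v $ j *\<^sub>R (0, axis j 1))"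
    by (simp add: prod_eq_iff fst_sum snd_sum vec_eq_iff sum_axis)
  then have "dd (0, v) f z = dd (\<Sum>j\<in>UNIV. v $ j *\<^sub>R (0, axis j 1)) f z" by (rule arg_cong)
  then show ?thesis
    unfolding linear_sum[OF linear_dd[OF assms]] linear_scale[OF linear_dd[OF assms]] by simp
qed

lemma dd_eq_sum_dX:
  assumes "f differentiable (at z)"
  shows "dd (v, 0) f z = (\<Sum>j\<in>UNIV. v $ j * dX j f z)"
proof -
  have "(v, 0) = (\<Sum>j\<in>UNIV. v $ j *\<^sub>R (axis j 1, 0))"
    by (simp add: prod_eq_iff fst_sum snd_sum vec_eq_iff sum_axis)
  then have "dd (v, 0) f z = dd (\<Sum>j\<in>UNIV. v $ j *\<^sub>R (axis j 1, 0)) f z" by (rule arg_cong)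
  then show ?thesis
    unfolding linear_sum[OF linear_dd[OF assms]] linear_scale[OF linear_dd[OF assms]] by simp
qed

lemma pd_eq_dd: "pd k f z = dd (axis k 1) f z"
  by (simp add: pd_def dd_def)

locale slit_bundle =
  fixes U :: "(real^'n) set"
  assumes open_U: "open U"
begin

abbreviation "S \<equiv> slit_tangent_bundle U"

abbreviation "smooth \<equiv> C_infinity_on S"

lemma open_S: "open S"
  by (intro open_Times open_U open_Diff) auto

lemmas differentiable = C_infinity_on_differentiable[of S]

lemma smooth_fst: "smooth (\<lambda>z. fst z $ k)"
  by (rule C_infinity_on_linear[OF bounded_linear_compose[OF bounded_linear_vec_nth bounded_linear_fst]])

lemma smooth_snd: "smooth (\<lambda>z. snd z $ k)"
  by (rule C_infinity_on_linear[OF bounded_linear_compose[OF bounded_linear_vec_nth bounded_linear_snd]])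

lemmas smooth_intros = C_infinity_on_dd[of S] C_infinity_on_const[of S]
  C_infinity_on_add[OF open_S] C_infinity_on_mult[OF open_S] C_infinity_on_diff[OF open_S]
  C_infinity_on_sum[OF open_S] smooth_fst smooth_snd

lemma dd_rules:
  assumes "z \<in> S"
  shows "smooth f \<Longrightarrow> smooth g \<Longrightarrow> dd v (\<lambda>z. f z + g z) z = dd v f z + dd v g z"
    and "smooth f \<Longrightarrow> smooth g \<Longrightarrow> dd v (\<lambda>z. f z - g z) z = dd v f z - dd v g z"
    and "smooth f \<Longrightarrow> smooth g \<Longrightarrow> dd v (\<lambda>z. f z * g z) z = f z * dd v g z + dd v f z * g z"
    and "(\<And>i. i \<in> I \<Longrightarrow> smooth (h i)) \<Longrightarrow> dd v (\<lambda>z. \<Sum>i\<in>I. h i z) z = (\<Sum>i\<in>I. dd v (h i) z)"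
    and "dd v (\<lambda>z. c) z = 0"
  using assms by (auto intro!: dd_add dd_diff dd_mult dd_sum differentiable simp: dd_const)

lemmas dd_simps = dd_rules dd_fst dd_snd smooth_intros

lemmas dd_S_cong = dd_cong[OF open_S]

lemmas dd_S_commute = dd_commute[OF open_S]

text \<open>Agreement is asked for on \<open>S\<close> only, so the rule can be applied to its own
  result; iterated curried partial derivatives are translated in this way.\<close>

lemma pd_x_eq:
  assumes f: "\<And>x y. (x, y) \<in> S \<Longrightarrow> f x y = g (x, y)" and g: "smooth g" and z: "(x, y) \<in> S"
  shows "pd k (\<lambda>x'. f x' y) x = dX k g (x, y)"
proof -
  have "pd k (\<lambda>x'. f x' y) x = dd (axis k 1) (\<lambda>x'. g (x', y)) x"
    unfolding pd_eq_dd by (rule dd_cong[OF open_U]) (use f z in auto)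
  also have "\<dots> = dX k g (x, y)"
    by (rule dd_eqI[OF dd_chain[where g = "\<lambda>x'. (x', y)", OF differentiable[OF g z]]]) (auto intro!: derivative_eq_intros)
  finally show ?thesis .
qed

lemma pd_y_eq:
  assumes f: "\<And>x y. (x, y) \<in> S \<Longrightarrow> f x y = g (x, y)" and g: "smooth g" and z: "(x, y) \<in> S"
  shows "pd k (f x) y = dY k g (x, y)"
proof -
  have "pd k (f x) y = dd (axis k 1) (\<lambda>y'. g (x, y')) y"
    unfolding pd_eq_dd by (rule dd_cong[of "UNIV - {0}"]) (use f z in auto)
  also have "\<dots> = dY k g (x, y)"
    by (rule dd_eqI[OF dd_chain[where g = "\<lambda>y'. (x, y')", OF differentiable[OF g z]]]) (auto intro!: derivative_eq_intros)
  finally show ?thesis .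
qed

subsection \<open>Homogeneity\<close>

text \<open>Homogeneity of degree \<open>d\<close> in its infinitesimal form, which survives
  differentiation in \<open>x\<close> and in \<open>y\<close>.\<close>

definition euler :: "real \<Rightarrow> ((real^'n) \<times> (real^'n) \<Rightarrow> real) \<Rightarrow> bool" where
  "euler d f \<longleftrightarrow> (\<forall>z\<in>S. (\<Sum>j\<in>UNIV. snd z $ j * dY j f z) = d * f z)"

lemma eulerD: "euler d f \<Longrightarrow> z \<in> S \<Longrightarrow> (\<Sum>j\<in>UNIV. snd z $ j * dY j f z) = d * f z"
  unfolding euler_def by blast

lemma euler_if_homogeneous:
  assumes f: "smooth f" and hom: "\<And>x y r. (x, y) \<in> S \<Longrightarrow> r > 0 \<Longrightarrow> f (x, r *\<^sub>R y) = r * f (x, y)"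
  shows "euler 1 f"
  unfolding euler_def
proof
  fix z assume z: "z \<in> S"
  have "((\<lambda>r. (fst z, r *\<^sub>R snd z)) has_derivative (\<lambda>h. (0, h *\<^sub>R snd z))) (at 1)"
    by (auto intro!: derivative_eq_intros)
  moreover have "f differentiable (at (fst z, (1::real) *\<^sub>R snd z))"
    using differentiable[OF f z] by simp
  ultimately have "((\<lambda>r. f (fst z, r *\<^sub>R snd z)) has_derivative (\<lambda>h. dd (0, h *\<^sub>R snd z) f z)) (at 1)"
    using dd_chain[of f "\<lambda>r. (fst z, r *\<^sub>R snd z)" 1] by simp
  moreover have "((\<lambda>r. f (fst z, r *\<^sub>R snd z)) has_derivative (\<lambda>h. h * f z)) (at 1)"
  proof (rule has_derivative_transform_within_open)
    show "((\<lambda>r. r * f z) has_derivative (\<lambda>h. h * f z)) (at 1)"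
      by (auto intro!: derivative_eq_intros)
    show "r * f z = f (fst z, r *\<^sub>R snd z)" if "r \<in> {0<..}" for r
      using hom[of "fst z" "snd z" r] z that by simp
  qed auto
  ultimately have "(\<lambda>h. dd (0, h *\<^sub>R snd z) f z) = (\<lambda>h. h * f z)"
    by (rule has_derivative_unique)
  from fun_cong[OF this, of 1] show "(\<Sum>j\<in>UNIV. snd z $ j * dY j f z) = 1 * f z"
    using dd_eq_sum_dY[OF differentiable[OF f z], of "snd z"] by simp
qed

lemma euler_mult:
  assumes "smooth f" "smooth g" "euler a f" "euler b g"
  shows "euler (a + b) (\<lambda>z. f z * g z)"
  unfolding euler_def
proof
  fix z assume z: "z \<in> S"
  have "(\<Sum>j\<in>UNIV. snd z $ j * dY j (\<lambda>z. f z * g z) z)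
      = f z * (\<Sum>j\<in>UNIV. snd z $ j * dY j g z) + (\<Sum>j\<in>UNIV. snd z $ j * dY j f z) * g z"
    using assms z
    by (simp add: dd_simps algebra_simps sum.distrib sum_distrib_left sum_distrib_right)
  then show "(\<Sum>j\<in>UNIV. snd z $ j * dY j (\<lambda>z. f z * g z) z) = (a + b) * (f z * g z)"
    using eulerD[OF assms(3) z] eulerD[OF assms(4) z] by (simp add: algebra_simps)
qed

lemma euler_dX:
  assumes f: "smooth f" and "euler d f"
  shows "euler d (dX k f)"
  unfolding euler_def
proof
  fix z assume z: "z \<in> S"
  have "dX k (\<lambda>z. \<Sum>j\<in>UNIV. snd z $ j * dY j f z) z = dX k (\<lambda>z. d * f z) z"
    by (rule dd_S_cong[OF z]) (rule eulerD[OF assms(2)])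
  then show "(\<Sum>j\<in>UNIV. snd z $ j * dY j (dX k f) z) = d * dX k f z"
    using z f by (simp add: dd_simps dd_S_commute[OF z f, of "(0, _)" "(_, 0)"])
qed

text \<open>Differentiating Euler's identity in \<open>y^k\<close> also hits the factor
  \<open>y^k\<close>; the extra term \<open>dY k f\<close> accounts for the loss of one
  degree.\<close>

lemma euler_dY:
  assumes f: "smooth f" and "euler d f"
  shows "euler (d - 1) (dY k f)"
  unfolding euler_def
proof
  fix z assume z: "z \<in> S"
  have "dY k (\<lambda>z. \<Sum>j\<in>UNIV. snd z $ j * dY j f z) z = dY k (\<lambda>z. d * f z) z"
    by (rule dd_S_cong[OF z]) (rule eulerD[OF assms(2)])
  then have "(\<Sum>j\<in>UNIV. snd z $ j * dY k (dY j f) z) = (d - 1) * dY k f z"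
    using z f by (simp add: dd_simps sum.distrib sum_axis algebra_simps)
  moreover have "dY k (dY j f) z = dY j (dY k f) z" for j
    by (rule dd_S_commute[OF z f])
  ultimately show "(\<Sum>j\<in>UNIV. snd z $ j * dY j (dY k f) z) = (d - 1) * dY k f z"
    by simp
qed

subsection \<open>The curvature of a spray with straight geodesics\<close>

definition riemann :: "('n \<Rightarrow> (real^'n) \<times> (real^'n) \<Rightarrow> real) \<Rightarrow> 'n \<Rightarrow> 'n \<Rightarrow> (real^'n) \<times> (real^'n) \<Rightarrow> real" where
  "riemann G i k z = 2 * dX k (G i) z - (\<Sum>j\<in>UNIV. snd z $ j * dX j (dY k (G i)) z)
     + 2 * (\<Sum>j\<in>UNIV. G j z * dY j (dY k (G i)) z) - (\<Sum>j\<in>UNIV. dY j (G i) z * dY k (G j) z)"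

text \<open>The first term is a multiple of the identity, the second has rank one with image along
  \<open>y\<close>. The latter disappears on flags orthogonal to \<open>y\<close>, so the first
  coefficient is what the flag curvature detects.\<close>

lemma riemann_projective:
  assumes P: "smooth P" "euler 1 P" and z: "z \<in> S"
  shows "riemann (\<lambda>i z. P z * snd z $ i) i k z =
    ((P z)\<^sup>2 - (\<Sum>j\<in>UNIV. snd z $ j * dX j P z)) * axis k 1 $ i
    + (2 * dX k P z - (\<Sum>j\<in>UNIV. snd z $ j * dX j (dY k P) z) - P z * dY k P z) * snd z $ i"
proof -
  have G1: "dY k (\<lambda>z. P z * snd z $ i) z = P z * axis k 1 $ i + dY k P z * snd z $ i"
    if "z \<in> S" for k i z
    using P that by (simp add: dd_simps)
  have G2: "dd v (dY k (\<lambda>z. P z * snd z $ i)) z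
      = dd v P z * axis k 1 $ i + dd v (dY k P) z * snd z $ i + dY k P z * snd v $ i" for v
    using dd_S_cong[where v = v, OF z G1] P z by (simp add: dd_simps algebra_simps)
  have e1: "(\<Sum>j\<in>UNIV. snd z $ j * dY j P z) = P z"
    using eulerD[OF P(2) z] by simp
  have e2: "(\<Sum>j\<in>UNIV. snd z $ j * dY j (dY k P) z) = 0"
    using eulerD[OF euler_dY[OF P] z] by simp
  have "(\<Sum>j\<in>UNIV. snd z $ j * dX j (dY k (\<lambda>z. P z * snd z $ i)) z)
      = (\<Sum>j\<in>UNIV. snd z $ j * dX j P z) * axis k 1 $ i
        + (\<Sum>j\<in>UNIV. snd z $ j * dX j (dY k P) z) * snd z $ i"
    by (simp add: G2 algebra_simps sum.distrib sum_distrib_left sum_distrib_right)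
  moreover have "(\<Sum>j\<in>UNIV. P z * snd z $ j * dY j (dY k (\<lambda>z. P z * snd z $ i)) z)
      = P z * (P z * axis k 1 $ i + dY k P z * snd z $ i)"
  proof -
    have "(\<Sum>j\<in>UNIV. P z * snd z $ j * dY j (dY k (\<lambda>z. P z * snd z $ i)) z)
      = P z * ((\<Sum>j\<in>UNIV. snd z $ j * dY j P z) * axis k 1 $ i
        + (\<Sum>j\<in>UNIV. snd z $ j * dY j (dY k P) z) * snd z $ i
        + dY k P z * (\<Sum>j\<in>UNIV. snd z $ j * axis j 1 $ i))"
      unfolding G2 by (simp add: algebra_simps sum.distrib sum_distrib_left sum_distrib_right)
    then show ?thesis unfolding e1 e2 sum_axis by simp
  qed
  \<comment> \<open>Of the four products, one gives the identity part and the other three each give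
    \<open>P z * dY k P z * snd z $ i\<close>, the last of them by Euler's identity.\<close>
  moreover have "(\<Sum>j\<in>UNIV. dY j (\<lambda>z. P z * snd z $ i) z * dY k (\<lambda>z. P z * snd z $ j) z)
      = (P z)\<^sup>2 * axis k 1 $ i + 3 * (P z * dY k P z * snd z $ i)"
  proof -
    have "(\<Sum>j\<in>UNIV. dY j (\<lambda>z. P z * snd z $ i) z * dY k (\<lambda>z. P z * snd z $ j) z)
      = P z * P z * (\<Sum>j\<in>UNIV. axis j 1 $ i * axis k 1 $ j)
        + P z * dY k P z * (\<Sum>j\<in>UNIV. axis j 1 $ i * snd z $ j)
        + P z * snd z $ i * (\<Sum>j\<in>UNIV. dY j P z * axis k 1 $ j)
        + snd z $ i * dY k P z * (\<Sum>j\<in>UNIV. snd z $ j * dY j P z)"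
      unfolding G1[OF z] by (simp add: algebra_simps sum.distrib sum_distrib_left sum_distrib_right)
    then show ?thesis unfolding e1 sum_axis by (simp add: algebra_simps power2_eq_square)
  qed
  moreover have "dX k (\<lambda>z. P z * snd z $ i) z = dX k P z * snd z $ i"
    using P z by (simp add: dd_simps)
  ultimately show ?thesis
    unfolding riemann_def by (simp add: algebra_simps power2_eq_square)
qed

end

section \<open>Projectively flat Finsler metrics\<close>

lemma invertible_if_positive_definite:
  fixes A :: "real^'n^'n"
  assumes "\<And>v. v \<noteq> 0 \<Longrightarrow> 0 < v \<bullet> (A *v v)"
  shows "invertible A"
proof -
  have "inj ((*v) A)"
    by (rule linear_injective_0[THEN iffD2]) (use assms in fastforce)+
  then show ?thesis
    using invertible_left_inverse matrix_left_invertible_injective by blast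
qed

locale finsler = slit_bundle U for U :: "(real^'n) set" +
  fixes F :: "(real^'n) \<times> (real^'n) \<Rightarrow> real"
  assumes smooth_F: "smooth F" and F_pos: "z \<in> S \<Longrightarrow> 0 < F z" and euler_F: "euler 1 F"
    and fundamental_pos:
      "z \<in> S \<Longrightarrow> v \<noteq> 0 \<Longrightarrow> 0 < v \<bullet> ((\<chi> i j. dY j (dY i (\<lambda>z. F z * F z / 2)) z) *v v)"
begin

definition g :: "(real^'n) \<times> (real^'n) \<Rightarrow> real^'n^'n" where
  "g z = (\<chi> i j. dY j (dY i (\<lambda>z. F z * F z / 2)) z)"

definition spray_rhs :: "'n \<Rightarrow> (real^'n) \<times> (real^'n) \<Rightarrow> real" where
  "spray_rhs l z = (\<Sum>m\<in>UNIV. dY l (dX m (\<lambda>z. F z * F z)) z * snd z $ m) - dX l (\<lambda>z. F z * F z) z"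

definition G :: "'n \<Rightarrow> (real^'n) \<times> (real^'n) \<Rightarrow> real" where
  "G i z = 1/4 * (\<Sum>l\<in>UNIV. matrix_inv (g z) $ i $ l * spray_rhs l z)"

text \<open>Defined for every \<open>F\<close>; that it is the only candidate for a projective
  factor is shown by contraction with \<open>y\<close>.\<close>

definition P :: "(real^'n) \<times> (real^'n) \<Rightarrow> real" where
  "P z = (\<Sum>k\<in>UNIV. snd z $ k * dX k F z) / (2 * F z)"

lemma F_nonzero: "z \<in> S \<Longrightarrow> F z \<noteq> 0"
  using F_pos by fastforce

lemma smooth_energy: "smooth (\<lambda>z. F z * F z / 2)"
  by (intro C_infinity_on_divide open_S smooth_intros smooth_F) simp

lemma dd_energy:
  assumes "z \<in> S"
  shows "dd v (\<lambda>z. F z * F z / 2) z = F z * dd v F z"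
proof -
  have "dd v (\<lambda>z. (1/2) * (F z * F z)) z = F z * dd v F z"
    using assms smooth_F by (simp add: dd_rules smooth_intros del: times_divide_eq_left)
  then show ?thesis by simp
qed

lemma smooth_g: "smooth (\<lambda>z. g z $ i $ j)"
  unfolding g_def by (simp add: C_infinity_on_dd smooth_energy)

lemma smooth_spray_rhs: "smooth (spray_rhs l)"
  unfolding spray_rhs_def[abs_def] by (intro smooth_intros smooth_F)

lemma smooth_P: "smooth P"
proof -
  have "smooth (\<lambda>z. (\<Sum>k\<in>UNIV. snd z $ k * dX k F z) / (2 * F z))"
    using F_nonzero by (intro C_infinity_on_divide open_S smooth_intros smooth_F) auto
  then show ?thesis by (simp add: P_def[abs_def])
qed

lemma sum_snd_dX_F: "z \<in> S \<Longrightarrow> (\<Sum>k\<in>UNIV. snd z $ k * dX k F z) = 2 * (P z * F z)"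
  using F_nonzero by (simp add: P_def)

lemma euler_sum_snd_dX:
  assumes f: "smooth f" "euler d f"
  shows "euler (1 + d) (\<lambda>z. \<Sum>k\<in>UNIV. snd z $ k * dX k f z)"
  unfolding euler_def
proof
  fix z assume z: "z \<in> S"
  have "(\<Sum>j\<in>UNIV. snd z $ j * dY j (\<lambda>z. \<Sum>k\<in>UNIV. snd z $ k * dX k f z) z)
      = (\<Sum>j\<in>UNIV. \<Sum>k\<in>UNIV. snd z $ k * (snd z $ j * dY j (dX k f) z)) + (\<Sum>j\<in>UNIV. snd z $ j * dX j f z)"
    using f z by (simp add: dd_simps sum.distrib sum_axis algebra_simps sum_distrib_left)
  also have "(\<Sum>j\<in>UNIV. \<Sum>k\<in>UNIV. snd z $ k * (snd z $ j * dY j (dX k f) z))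
      = (\<Sum>k\<in>UNIV. snd z $ k * (\<Sum>j\<in>UNIV. snd z $ j * dY j (dX k f) z))"
    by (subst sum.swap) (simp add: sum_distrib_left)
  also have "\<dots> = (\<Sum>k\<in>UNIV. snd z $ k * (d * dX k f z))"
    by (simp add: eulerD[OF euler_dX[OF f] z])
  finally show "(\<Sum>j\<in>UNIV. snd z $ j * dY j (\<lambda>z. \<Sum>k\<in>UNIV. snd z $ k * dX k f z) z)
      = (1 + d) * (\<Sum>k\<in>UNIV. snd z $ k * dX k f z)"
    by (simp add: algebra_simps sum_distrib_left sum.distrib)
qed

text \<open>Instead of differentiating a quotient, the degrees in \<open>y^k F_{x^k} = 2 P F\<close>
  are compared: the left side has degree two and \<open>F\<close> has degree one.\<close>

lemma euler_P: "euler 1 P"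
  unfolding euler_def
proof
  fix z assume z: "z \<in> S"
  note smooth = smooth_P smooth_F
  have "(\<Sum>j\<in>UNIV. snd z $ j * dY j (\<lambda>z. \<Sum>k\<in>UNIV. snd z $ k * dX k F z) z)
      = (\<Sum>j\<in>UNIV. snd z $ j * dY j (\<lambda>z. 2 * (P z * F z)) z)"
    by (intro sum.cong arg_cong[of _ _ "(*) _"] dd_S_cong[OF z] refl sum_snd_dX_F)
  also have "\<dots> = 2 * (P z * (\<Sum>j\<in>UNIV. snd z $ j * dY j F z) + (\<Sum>j\<in>UNIV. snd z $ j * dY j P z) * F z)"
    using z smooth by (simp add: dd_simps algebra_simps sum.distrib sum_distrib_left sum_distrib_right)
  finally have "2 * (2 * (P z * F z)) = 2 * (P z * F z + (\<Sum>j\<in>UNIV. snd z $ j * dY j P z) * F z)"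
    using eulerD[OF euler_sum_snd_dX[OF smooth_F euler_F] z] eulerD[OF euler_F z] sum_snd_dX_F[OF z]
    by simp
  then show "(\<Sum>j\<in>UNIV. snd z $ j * dY j P z) = 1 * P z"
    using F_nonzero[OF z] by simp
qed

lemma g_symmetric: "z \<in> S \<Longrightarrow> g z $ i $ j = g z $ j $ i"
  unfolding g_def using dd_S_commute[of z "\<lambda>z. F z * F z / 2"] by (simp add: smooth_energy)

lemma g_pos: "z \<in> S \<Longrightarrow> v \<noteq> 0 \<Longrightarrow> 0 < v \<bullet> (g z *v v)"
  unfolding g_def by (rule fundamental_pos)

text \<open>\<open>F\<^sup>2 / 2\<close> has degree two, so its gradient in \<open>y\<close> has
  degree one; this is Euler's identity for that gradient.\<close>

lemma g_snd:
  assumes z: "z \<in> S"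
  shows "(\<Sum>j\<in>UNIV. g z $ i $ j * snd z $ j) = F z * dY i F z"
proof -
  have "(\<Sum>j\<in>UNIV. snd w $ j * (F w * dY j F w)) = F w * F w" if "w \<in> S" for w
    using arg_cong[OF eulerD[OF euler_F that], of "(*) (F w)"]
    by (simp add: sum_distrib_left algebra_simps)
  then have "euler 2 (\<lambda>z. F z * F z / 2)"
    unfolding euler_def by (simp add: dd_energy)
  from eulerD[OF euler_dY[OF smooth_energy this] z, of i]
  have "(\<Sum>j\<in>UNIV. g z $ i $ j * snd z $ j) = dY i (\<lambda>z. F z * F z / 2) z"
    by (simp add: g_def mult.commute)
  also have "\<dots> = F z * dY i F z"
    by (rule dd_energy[OF z])
  finally show ?thesis .
qed

text \<open>An identity for every Finsler metric: differentiating \<open>sum_snd_dX_F\<close> in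
  \<open>y^l\<close> expresses the contracted mixed derivatives of \<open>F\<close> through
  \<open>P\<close>.\<close>

lemma spray_rhs_eq:
  assumes z: "z \<in> S"
  shows "1/4 * spray_rhs l z = dY l (\<lambda>z. P z * (F z * F z)) z - F z * dX l F z"
proof -
  note sm = smooth_F smooth_P
  have 1: "dd v (dX m (\<lambda>z. F z * F z)) z = 2 * (dd v F z * dX m F z + F z * dd v (dX m F) z)" for m v
  proof -
    have "dd v (dX m (\<lambda>z. F z * F z)) z = dd v (\<lambda>z. 2 * (F z * dX m F z)) z"
      by (rule dd_S_cong[OF z]) (use sm in \<open>simp add: dd_simps\<close>)
    then show ?thesis using sm z by (simp add: dd_simps)
  qed
  have 2: "dY l (\<lambda>z. \<Sum>k\<in>UNIV. snd z $ k * dX k F z) z = dX l F z + (\<Sum>m\<in>UNIV. snd z $ m * dY l (dX m F) z)"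
    using sm z by (simp add: dd_simps sum.distrib sum_axis)
  have 3: "dY l (\<lambda>z. \<Sum>k\<in>UNIV. snd z $ k * dX k F z) z = dY l (\<lambda>z. 2 * (P z * F z)) z"
    by (rule dd_S_cong[OF z]) (rule sum_snd_dX_F)
  have "(\<Sum>m\<in>UNIV. dY l (dX m (\<lambda>z. F z * F z)) z * snd z $ m)
      = 2 * dY l F z * (\<Sum>m\<in>UNIV. snd z $ m * dX m F z) + 2 * F z * (\<Sum>m\<in>UNIV. snd z $ m * dY l (dX m F) z)"
    unfolding 1 by (simp add: algebra_simps sum.distrib sum_distrib_left)
  also have "\<dots> = 2 * dY l F z * (2 * (P z * F z)) + 2 * F z * (dY l (\<lambda>z. 2 * (P z * F z)) z - dX l F z)"
    using 2 3 sum_snd_dX_F[OF z] by simp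
  finally show ?thesis
    unfolding spray_rhs_def using sm z by (simp add: dd_simps algebra_simps)
qed

lemma g_invertible: "z \<in> S \<Longrightarrow> invertible (g z)"
  using invertible_if_positive_definite g_pos by blast

lemma G_vector: "(\<chi> i. G i z) = (1/4) *\<^sub>R (matrix_inv (g z) *v (\<chi> l. spray_rhs l z))"
  by (simp add: G_def vec_eq_iff matrix_vector_mult_def)

lemma g_G:
  assumes "z \<in> S"
  shows "g z *v (\<chi> i. G i z) = (1/4) *\<^sub>R (\<chi> l. spray_rhs l z)"
proof -
  have "g z ** matrix_inv (g z) = mat 1"
    using g_invertible[OF assms] unfolding invertible_def matrix_inv_def
    by (rule someI2_ex) blast
  then show ?thesis
    unfolding G_vector by (simp add: matrix_vector_mult_scaleR matrix_vector_mul_assoc)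
qed

text \<open>Cramer's rule replaces \<open>matrix_inv\<close> by a quotient of determinants, which
  are polynomials in smooth entries.\<close>

lemma smooth_G: "smooth (G k)"
proof -
  have det: "det (g z) \<noteq> 0" if "z \<in> S" for z
    using g_invertible[OF that] invertible_det_nz by blast
  have eq: "det (\<chi> i j. if j = k then 1/4 * spray_rhs i z else g z $ i $ j) / det (g z) = G k z"
    if z: "z \<in> S" for z
  proof -
    have "(\<chi> i. G i z) = (\<chi> k. det (\<chi> i j. if j = k then ((1/4) *\<^sub>R (\<chi> l. spray_rhs l z)) $ i else g z $ i $ j) / det (g z))"
      using cramer[OF det[OF z]] g_G[OF z] by blast
    from arg_cong[OF this, of "\<lambda>v. v $ k"] show ?thesis by (simp cong: if_cong)
  qed
  have "smooth (\<lambda>z. if j = k then 1/4 * spray_rhs i z else g z $ i $ j)" for i j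
    by (cases "j = k") (simp_all add: smooth_g smooth_spray_rhs smooth_intros del: times_divide_eq_left mult_1)
  then have "smooth (\<lambda>z. det (\<chi> i j. if j = k then 1/4 * spray_rhs i z else g z $ i $ j) / det (g z))"
    using det by (intro C_infinity_on_divide open_S C_infinity_on_det) (simp_all add: smooth_g)
  then show ?thesis
    by (rule C_infinity_on_cong[OF open_S, rotated]) (rule eq)
qed

section \<open>Hamel's equation and the projective factor\<close>

definition hamel :: "((real^'n) \<times> (real^'n) \<Rightarrow> real) \<Rightarrow> bool" where
  "hamel Q \<longleftrightarrow> (\<forall>z\<in>S. \<forall>l. dX l F z = dY l (\<lambda>z. Q z * F z) z)"

text \<open>The multiplier \<open>p\<close> is given pointwise only. Lowering the index with
  \<open>g\<close> yields \<open>p F F_{y^l} = (P F^2)_{y^l} - F F_{x^l}\<close>; contracted with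
  \<open>y\<close> the right side is \<open>3 P F^2 - 2 P F^2\<close>, hence \<open>p = P\<close>.
  Reinserting this and dividing by \<open>F\<close> leaves Hamel's equation.\<close>

lemma straight_imp_projective:
  assumes "\<And>z. z \<in> S \<Longrightarrow> \<exists>p. \<forall>i. G i z = p * snd z $ i"
  shows "hamel P" and "z \<in> S \<Longrightarrow> G i z = P z * snd z $ i"
proof -
  note sm = smooth_F smooth_P
  have main: "(\<forall>i. G i z = P z * snd z $ i) \<and> (\<forall>l. dX l F z = dY l (\<lambda>z. P z * F z) z)" if z: "z \<in> S" for z
  proof -
    obtain p where p: "\<And>i. G i z = p * snd z $ i" using assms z by blast
    have e: "p * (F z * dY l F z) = dY l (\<lambda>z. P z * (F z * F z)) z - F z * dX l F z" for l
    proof -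
      have "p * (F z * dY l F z) = (g z *v (\<chi> i. G i z)) $ l"
        using g_snd[OF z, of l] by (simp add: matrix_vector_mult_def p sum_distrib_left algebra_simps flip: g_snd[OF z])
      then show ?thesis using g_G[OF z] spray_rhs_eq[OF z, of l] by simp
    qed
    have "p * (F z * (\<Sum>l\<in>UNIV. snd z $ l * dY l F z)) = (\<Sum>l\<in>UNIV. snd z $ l * (p * (F z * dY l F z)))"
      by (simp add: sum_distrib_left algebra_simps)
    also have "\<dots> = (\<Sum>l\<in>UNIV. snd z $ l * dY l (\<lambda>z. P z * (F z * F z)) z) - F z * (\<Sum>l\<in>UNIV. snd z $ l * dX l F z)"
      unfolding e by (simp add: sum_distrib_left algebra_simps sum_subtractf)
    also have "(\<Sum>l\<in>UNIV. snd z $ l * dY l (\<lambda>z. P z * (F z * F z)) z) = 3 * (P z * (F z * F z))"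
    proof -
      have "euler (1 + (1 + 1)) (\<lambda>z. P z * (F z * F z))"
        using sm by (intro euler_mult euler_P euler_F) (auto intro: smooth_intros)
      from eulerD[OF this z] show ?thesis by simp
    qed
    finally have "p * (F z * F z) = P z * (F z * F z)"
      using sum_snd_dX_F[OF z] eulerD[OF euler_F z] by simp
    then have pP: "p = P z" using F_nonzero[OF z] by simp
    have "F z * dX l F z = F z * dY l (\<lambda>z. P z * F z) z" for l
      using e[of l] sm z unfolding pP by (simp add: dd_simps algebra_simps)
    then have "dX l F z = dY l (\<lambda>z. P z * F z) z" for l
      using F_nonzero[OF z] by (metis mult_left_cancel)
    then show ?thesis using p pP by blast
  qed
  then show "hamel P" unfolding hamel_def by blast
  show "z \<in> S \<Longrightarrow> G i z = P z * snd z $ i" using main by blast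
qed

text \<open>Contracted with \<open>y\<close>, the two sides of Hamel's equation become
  \<open>2 P F\<close>, by the definition of \<open>P\<close>, and \<open>2 Q F\<close>, by degree.
  This later identifies the function supplied by \<open>represents\<close> with
  \<open>P\<close>.\<close>

lemma projective_factor_unique:
  assumes Q: "smooth Q" "euler 1 Q" and "hamel Q" and z: "z \<in> S"
  shows "Q z = P z"
proof -
  have h: "dX l F z = dY l (\<lambda>z. Q z * F z) z" for l
    using assms by (auto simp: hamel_def)
  have "euler (1 + 1) (\<lambda>z. Q z * F z)"
    by (rule euler_mult[OF Q(1) smooth_F Q(2) euler_F])
  from eulerD[OF this z] sum_snd_dX_F[OF z] have "2 * (P z * F z) = 2 * (Q z * F z)"
    unfolding h by simp
  then show ?thesis using F_nonzero[OF z] by simp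
qed

text \<open>Under Hamel's equation both vectors have the image \<open>P F F_y\<close> under the
  injective matrix \<open>g z\<close>.\<close>

lemma hamel_imp_straight:
  assumes "hamel P" and z: "z \<in> S"
  shows "G i z = P z * snd z $ i"
proof -
  note sm = smooth_F smooth_P
  have h: "dX l F z = dY l (\<lambda>z. P z * F z) z" for l
    using assms by (auto simp: hamel_def)
  have "(g z *v (\<chi> i. G i z)) $ l = (g z *v (P z *\<^sub>R snd z)) $ l" for l
  proof -
    have "(g z *v (\<chi> i. G i z)) $ l = P z * (F z * dY l F z)"
      using g_G[OF z] spray_rhs_eq[OF z, of l] sm z unfolding h by (simp add: dd_simps algebra_simps)
    also have "\<dots> = (g z *v (P z *\<^sub>R snd z)) $ l"
      by (simp add: matrix_vector_mult_def sum_distrib_left algebra_simps flip: g_snd[OF z])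
    finally show ?thesis .
  qed
  then have "g z *v (\<chi> i. G i z) = g z *v (P z *\<^sub>R snd z)" by (simp add: vec_eq_iff)
  moreover have "inj ((*v) (g z))"
    using g_invertible[OF z] invertible_left_inverse matrix_left_invertible_injective by blast
  ultimately have "(\<chi> i. G i z) = P z *\<^sub>R snd z" by (meson injD)
  then show ?thesis by (simp add: vec_eq_iff)
qed

text \<open>\<open>E l\<close> measures the failure of \<open>P\<^sub>x = P P\<^sub>y\<close>. Equality of the mixed second \<open>x\<close>-derivatives of \<open>F\<close>
  makes \<open>(E k F)\<^sub>y\<^sub>l\<close> symmetric in \<open>k\<close> and \<open>l\<close>; contracting with \<open>y\<close>, Euler's identity turns this
  into \<open>2 E k F = - E k F\<close>.\<close>

lemma flat_imp_burgers:
  assumes hamel: "hamel P"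
    and flat: "\<And>z. z \<in> S \<Longrightarrow> (P z)\<^sup>2 = (\<Sum>j\<in>UNIV. snd z $ j * dX j P z)"
    and z: "z \<in> S"
  shows "dX k P z = P z * dY k P z"
proof -
  note sm = smooth_F smooth_P
  define E where "E l z = dX l P z - P z * dY l P z" for l z
  have smE: "smooth (E l)" for l
    unfolding E_def[abs_def] by (intro smooth_intros sm)
  have h: "dX l F z = dY l (\<lambda>z. P z * F z) z" if "z \<in> S" for l z
    using hamel that by (auto simp: hamel_def)
  \<comment> \<open>Hamel's equation removes \<open>dX k F\<close>. Everything but the
    \<open>E\<close> term collects into a \<open>y\<close>-derivative of \<open>P\<^sup>2 F\<close>,
    whose further \<open>y\<close>-derivative is symmetric in the two indices and cancels.\<close>
  have xPF: "dX k (\<lambda>z. P z * F z) z = E k z * F z + dY k (\<lambda>z. P z * P z * F z) z" if "z \<in> S" for k z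
    using that sm by (simp add: dd_simps h E_def algebra_simps)
  have mixed: "dX k (dX l F) z = dY l (\<lambda>z. E k z * F z) z + dY l (dY k (\<lambda>z. P z * P z * F z)) z" for k l
  proof -
    have "dX k (dX l F) z = dX k (dY l (\<lambda>z. P z * F z)) z"
      by (rule dd_S_cong[OF z h])
    also have "\<dots> = dY l (dX k (\<lambda>z. P z * F z)) z"
      by (rule dd_S_commute[OF z]) (intro smooth_intros sm)
    also have "\<dots> = dY l (\<lambda>z. E k z * F z + dY k (\<lambda>z. P z * P z * F z) z) z"
      by (rule dd_S_cong[OF z xPF])
    also have "\<dots> = dY l (\<lambda>z. E k z * F z) z + dY l (dY k (\<lambda>z. P z * P z * F z)) z"
      using z sm smE by (subst dd_rules(1)) (auto intro!: smooth_intros)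
    finally show ?thesis .
  qed
  have sym: "dY l (\<lambda>z. E k z * F z) z = dY k (\<lambda>z. E l z * F z) z" for l
  proof -
    have "dX k (dX l F) z = dX l (dX k F) z" by (rule dd_S_commute[OF z smooth_F])
    moreover have "dY l (dY k (\<lambda>z. P z * P z * F z)) z = dY k (dY l (\<lambda>z. P z * P z * F z)) z"
      by (rule dd_S_commute[OF z]) (intro smooth_intros sm)
    ultimately show ?thesis using mixed[of k l] mixed[of l k] by linarith
  qed
  have yE: "(\<Sum>l\<in>UNIV. snd z $ l * (E l z * F z)) = 0" if "z \<in> S" for z
  proof -
    have "(\<Sum>l\<in>UNIV. snd z $ l * (E l z * F z))
        = ((\<Sum>l\<in>UNIV. snd z $ l * dX l P z) - P z * (\<Sum>l\<in>UNIV. snd z $ l * dY l P z)) * F z"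
      by (simp add: E_def algebra_simps sum_subtractf sum_distrib_left sum_distrib_right)
    then show ?thesis
      using flat[OF that] eulerD[OF euler_P that] by (simp add: power2_eq_square)
  qed
  have "euler 2 (\<lambda>z. E k z * F z)"
  proof -
    have "euler (1 + 0) (\<lambda>z. P z * dY k P z)"
      using euler_mult[OF smooth_P C_infinity_on_dd[OF smooth_P] euler_P euler_dY[OF smooth_P euler_P]] by simp
    then have "euler 1 (E k)"
      using euler_dX[OF smooth_P euler_P, of k] sm unfolding euler_def E_def[abs_def]
      by (simp add: dd_simps algebra_simps sum.distrib sum_subtractf)
    from euler_mult[OF smE smooth_F this euler_F] show ?thesis by simp
  qed
  from eulerD[OF this z] have "2 * (E k z * F z) = (\<Sum>l\<in>UNIV. snd z $ l * dY k (\<lambda>z. E l z * F z) z)"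
    by (simp add: sym)
  also have "\<dots> = dY k (\<lambda>z. \<Sum>l\<in>UNIV. snd z $ l * (E l z * F z)) z - E k z * F z"
    using z sm smE by (simp add: dd_rules(1,3,4) dd_snd smooth_intros sum.distrib sum_axis)
  also have "dY k (\<lambda>z. \<Sum>l\<in>UNIV. snd z $ l * (E l z * F z)) z = dY k (\<lambda>z. 0) z"
    by (rule dd_S_cong[OF z yE])
  finally have "E k z * F z = 0" unfolding dd_const by linarith
  then have "E k z = 0" using F_nonzero[OF z] by simp
  then show ?thesis by (simp add: E_def)
qed

end

section \<open>Geodesics and straight lines\<close>

text \<open>The part \<open>w\<close> of \<open>y\<close> orthogonal to \<open>u\<close> is itself a
  test vector, so \<open>w\<close> is orthogonal to \<open>u\<close> and \<open>y\<close> and hence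
  to itself. For \<open>u = 0\<close> division by zero makes \<open>w = y\<close>, and the argument
  still applies.\<close>

lemma multiple_if_orthogonal:
  fixes u y :: "'a::real_inner"
  assumes "\<And>w. w \<bullet> u = 0 \<Longrightarrow> y \<bullet> w = 0"
  shows "\<exists>a. y = a *\<^sub>R u"
proof -
  define w where "w = y - (y \<bullet> u / (u \<bullet> u)) *\<^sub>R u"
  have wu: "w \<bullet> u = 0"
    by (cases "u = 0") (simp_all add: w_def inner_diff_left)
  then have "w \<bullet> w = 0"
    using assms[OF wu] by (simp add: inner_commute w_def inner_diff_left inner_diff_right)
  then show ?thesis by (auto simp: w_def)
qed

text \<open>A geodesic is started at \<open>z\<close>. If its image lies on a line with direction
  \<open>u\<close>, then velocity and acceleration are orthogonal to every \<open>q\<close>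
  orthogonal to \<open>u\<close>, so both \<open>y\<close> and \<open>G\<close> are multiples of
  \<open>u\<close>; as \<open>y\<close> is nonzero, \<open>G\<close> is a multiple of
  \<open>y\<close>.\<close>

lemma (in finsler) straight_if_geodesics_collinear:
  assumes flat: "\<And>J c v. open J \<Longrightarrow> is_interval J \<Longrightarrow>
      (\<forall>t\<in>J. c t \<in> U \<and> v t \<noteq> 0 \<and> (c has_vector_derivative v t) (at t) \<and>
        (v has_vector_derivative (\<chi> i. - 2 * G i (c t, v t))) (at t)) \<Longrightarrow> collinear (c ` J)"
    and z: "z \<in> S"
  shows "\<exists>p. \<forall>i. G i z = p * snd z $ i"
proof -
  define X where "X w = (snd w, \<chi> i. - 2 * G i w)" for w
  have "smooth (\<lambda>w. X w \<bullet> b)" for b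
  proof -
    have "smooth (\<lambda>w. (\<Sum>i\<in>UNIV. snd w $ i * fst b $ i) + (\<Sum>i\<in>UNIV. (- 2 * G i w) * snd b $ i))"
      by (intro smooth_intros smooth_G)
    then show ?thesis by (simp add: X_def inner_prod_def inner_vec_def)
  qed
  from flow_exists[OF open_S z this] obtain h w where h: "h > 0" "w 0 = z"
    and w: "\<And>t. t \<in> {-h<..<h} \<Longrightarrow> w t \<in> S"
      "\<And>t. t \<in> {-h<..<h} \<Longrightarrow> (w has_vector_derivative X (w t)) (at t)" by blast
  define J where "J = {-h<..<h}"
  have J: "open J" "is_interval J" "connected J" "0 \<in> J"
    using h by (auto simp: J_def is_interval_oo)
  define c where "c t = fst (w t)" for t
  define v where "v t = snd (w t)" for t
  have c': "(c has_vector_derivative v t) (at t)" if "t \<in> J" for t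
    using bounded_linear.has_vector_derivative[OF bounded_linear_fst w(2)] that
    by (simp add: J_def c_def[abs_def] v_def X_def)
  have v': "(v has_vector_derivative (\<chi> i. - 2 * G i (w t))) (at t)" if "t \<in> J" for t
    using bounded_linear.has_vector_derivative[OF bounded_linear_snd w(2)] that
    by (simp add: J_def v_def[abs_def] X_def)
  have wt: "c t \<in> U" "v t \<noteq> 0" if "t \<in> J" for t
    using w(1)[of t] that by (auto simp: J_def c_def v_def)
  have "collinear (c ` J)"
    by (rule flat[OF J(1,2), of c v]) (use c' v' wt in \<open>simp add: c_def v_def\<close>)
  then obtain u where u: "\<And>s t. s \<in> J \<Longrightarrow> t \<in> J \<Longrightarrow> \<exists>k. c s - c t = k *\<^sub>R u"
    unfolding collinear_def by blast
  have vq: "v t \<bullet> q = 0" if q: "q \<bullet> u = 0" and t: "t \<in> J" for q t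
  proof (rule vector_derivative_unique_at)
    show "((\<lambda>s. c s \<bullet> q) has_vector_derivative v t \<bullet> q) (at t)"
      by (rule bounded_linear.has_vector_derivative[OF bounded_linear_inner_left c'[OF t]])
    have eq: "c s \<bullet> q = c 0 \<bullet> q" if "s \<in> J" for s
    proof -
      obtain k where "c s - c 0 = k *\<^sub>R u" using u \<open>0 \<in> J\<close> \<open>s \<in> J\<close> by blast
      then have "(c s - c 0) \<bullet> q = 0" using q by (simp add: inner_commute)
      then show ?thesis by (simp add: inner_diff_left)
    qed
    show "((\<lambda>s. c s \<bullet> q) has_vector_derivative 0) (at t)"
      by (rule has_vector_derivative_transform_within_open[OF has_vector_derivative_const J(1) t])
        (simp add: eq)
  qed
  have Gq: "(\<chi> i. - 2 * G i z) \<bullet> q = 0" if q: "q \<bullet> u = 0" for q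
  proof (rule vector_derivative_unique_at)
    show "((\<lambda>s. v s \<bullet> q) has_vector_derivative (\<chi> i. - 2 * G i z) \<bullet> q) (at 0)"
      using bounded_linear.has_vector_derivative[OF bounded_linear_inner_left v'[OF J(4)]] h by simp
    show "((\<lambda>s. v s \<bullet> q) has_vector_derivative 0) (at 0)"
      by (rule has_vector_derivative_transform_within_open[OF has_vector_derivative_const J(1,4)])
        (simp add: vq[OF q])
  qed
  obtain a where a: "snd z = a *\<^sub>R u"
    using multiple_if_orthogonal[of u "snd z"] vq[OF _ J(4)] h by (auto simp: v_def)
  obtain b where b: "(\<chi> i. - 2 * G i z) = b *\<^sub>R u"
    using multiple_if_orthogonal[of u "\<chi> i. - 2 * G i z"] Gq by blast
  have "a \<noteq> 0" using a z by auto
  have "G i z = (- b / (2 * a)) * snd z $ i" for i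
  proof -
    have "- 2 * G i z = b * u $ i" using arg_cong[OF b, of "\<lambda>v. v $ i"] by simp
    then show ?thesis using \<open>a \<noteq> 0\<close> by (simp add: a field_simps)
  qed
  then show ?thesis by blast
qed

text \<open>Along the given curve \<open>Q\<close> is just a continuous coefficient, so each
  component of \<open>v\<close> orthogonal to \<open>v t0\<close> solves a scalar linear equation
  with zero initial value. It vanishes, and then so does the same component of
  \<open>c t - c t0\<close>.\<close>

lemma (in slit_bundle) collinear_if_straight:
  assumes Q: "smooth Q" and J: "open J" "is_interval J"
    and sol: "\<And>t. t \<in> J \<Longrightarrow> c t \<in> U \<and> v t \<noteq> 0 \<and> (c has_vector_derivative v t) (at t) \<and>
        (v has_vector_derivative (- 2 * Q (c t, v t)) *\<^sub>R v t) (at t)"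
  shows "collinear (c ` J)"
proof (cases "J = {}")
  case False
  then obtain t0 where t0: "t0 \<in> J" by blast
  have conn: "connected J" using J(2) is_interval_connected by blast
  have contQ: "continuous_on J (\<lambda>t. 2 * \<bar>Q (c t, v t)\<bar>)"
  proof -
    have "isCont c t" "isCont v t" if "t \<in> J" for t
      using sol[OF that] has_vector_derivative_continuous by blast+
    then have "continuous_on J c" "continuous_on J v"
      by (simp_all add: continuous_at_imp_continuous_on)
    then have "continuous_on J (\<lambda>t. (c t, v t))" by (intro continuous_intros)
    then have "continuous_on J (\<lambda>t. Q (c t, v t))"
      by (rule continuous_on_compose2[OF C_infinity_on_continuous_on[OF Q]]) (use sol in auto)
    then show ?thesis by (intro continuous_intros)
  qed
  have vq: "v t \<bullet> q = 0" if q: "q \<bullet> v t0 = 0" and t: "t \<in> J" for q t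
  proof (rule zero_if_derivative_bounded_by_self[where g = "\<lambda>t. v t \<bullet> q", OF J(1) conn t0 _ _ _ contQ t])
    show "v t0 \<bullet> q = 0" using q by (simp add: inner_commute)
    show "((\<lambda>t. v t \<bullet> q) has_derivative (\<lambda>h. h *\<^sub>R (((- 2 * Q (c s, v s)) *\<^sub>R v s) \<bullet> q))) (at s)"
      if "s \<in> J" for s
      using bounded_linear.has_vector_derivative[OF bounded_linear_inner_left, of v _ "at s"] sol[OF that]
      unfolding has_vector_derivative_def by blast
  qed (simp add: abs_mult)
  have cq: "(c t - c t0) \<bullet> q = 0" if q: "q \<bullet> v t0 = 0" and t: "t \<in> J" for q t
  proof (rule zero_if_derivative_bounded_by_self[where g = "\<lambda>t. (c t - c t0) \<bullet> q" and K = "\<lambda>_. 0",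
        OF J(1) conn t0 _ _ _ _ t])
    fix s assume s: "s \<in> J"
    have "((\<lambda>t. c t - c t0) has_vector_derivative v s - 0) (at s)"
      using sol[OF s] by (intro has_vector_derivative_diff has_vector_derivative_const) auto
    from bounded_linear.has_vector_derivative[OF bounded_linear_inner_left this, of q]
    show "((\<lambda>t. (c t - c t0) \<bullet> q) has_derivative (\<lambda>h. 0)) (at s)"
      using vq[OF q s] by (simp add: has_vector_derivative_def)
  qed auto
  have line: "\<exists>a. c t = c t0 + a *\<^sub>R v t0" if "t \<in> J" for t
  proof -
    have "\<exists>a. c t - c t0 = a *\<^sub>R v t0"
      by (rule multiple_if_orthogonal) (rule cq[OF _ that])
    then show ?thesis by (auto simp: algebra_simps intro!: exI[of _ a])
  qed
  show ?thesis
    unfolding collinear_alt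
    by (intro exI[of _ "c t0"] exI[of _ "v t0"]) (use line in auto)
qed simp

section \<open>The transport equation\<close>

context slit_bundle
begin

definition burgers :: "((real^'n) \<times> (real^'n) \<Rightarrow> real) \<Rightarrow> bool" where
  "burgers Q \<longleftrightarrow> (\<forall>z\<in>S. \<forall>k. dX k Q z = Q z * dY k Q z)"

text \<open>The Jacobian determinant of \<open>y \<mapsto> y + Q(x, y) x\<close>, whose differential
  is the identity plus a rank one map.\<close>

definition weight :: "((real^'n) \<times> (real^'n) \<Rightarrow> real) \<Rightarrow> (real^'n) \<times> (real^'n) \<Rightarrow> real" where
  "weight Q z = 1 + (\<Sum>k\<in>UNIV. dY k Q z * fst z $ k)"

lemma smooth_weight: "smooth Q \<Longrightarrow> smooth (weight Q)"
  unfolding weight_def[abs_def] by (intro smooth_intros)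

lemma burgers_dY:
  assumes Q: "smooth Q" "burgers Q" and z: "z \<in> S"
  shows "dX l (dY k Q) z = Q z * dY l (dY k Q) z + dY l Q z * dY k Q z"
proof -
  have "dX l (dY k Q) z = dY k (dX l Q) z"
    by (rule dd_S_commute[OF z Q(1)])
  also have "\<dots> = dY k (\<lambda>z. Q z * dY l Q z) z"
    by (rule dd_S_cong[OF z]) (use Q(2) in \<open>auto simp: burgers_def\<close>)
  also have "\<dots> = Q z * dY k (dY l Q) z + dY k Q z * dY l Q z"
    using z Q(1) by (simp add: dd_simps)
  finally show ?thesis using dd_S_commute[OF z Q(1)] by simp
qed

text \<open>This is Hamel's equation with the weight in place of \<open>F\<close>. Differentiating
  the factor \<open>x^l\<close> leaves a lone \<open>dY l Q\<close>, which the constant 1 in the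
  weight absorbs.\<close>

lemma weight_transport:
  assumes Q: "smooth Q" "burgers Q" and z: "z \<in> S"
  shows "dX l (weight Q) z = Q z * dY l (weight Q) z + dY l Q z * weight Q z"
  unfolding weight_def[abs_def] using z Q(1)
  by (simp add: burgers_dY[OF Q z] dd_simps sum.distrib sum_axis algebra_simps sum_distrib_left)

text \<open>By Euler's identity, \<open>f (x, s y) - s f (x, y)\<close> solves
  \<open>s d' = d\<close> along the ray and vanishes at \<open>s = 1\<close>.\<close>

lemma homogeneous_if_euler:
  assumes f: "smooth f" "euler 1 f" and z: "(x, y) \<in> S" and r: "r > 0"
  shows "f (x, r *\<^sub>R y) = r * f (x, y)"
proof -
  have zs: "(x, s *\<^sub>R y) \<in> S" if "s \<in> {0<..}" for s :: real
    using z that by auto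
  have "f (x, r *\<^sub>R y) - r * f (x, y) = 0"
  proof (rule zero_if_derivative_bounded_by_self[where U = "{0<..}" and K = "\<lambda>s. 1 / s"
        and g = "\<lambda>s. f (x, s *\<^sub>R y) - s * f (x, y)" and ?x0.0 = 1])
    fix s :: real assume s: "s \<in> {0<..}"
    have e: "dd (0, y) f (x, s *\<^sub>R y) = f (x, s *\<^sub>R y) / s"
    proof -
      have "s * dd (0, y) f (x, s *\<^sub>R y) = f (x, s *\<^sub>R y)"
        using eulerD[OF f(2) zs[OF s]] dd_eq_sum_dY[OF differentiable[OF f(1) zs[OF s]], of y]
        by (simp add: sum_distrib_left algebra_simps)
      then show ?thesis using s by (simp add: field_simps)
    qed
    have "((\<lambda>s. (x, s *\<^sub>R y)) has_derivative (\<lambda>h. (0, h *\<^sub>R y))) (at s)"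
      by (auto intro!: derivative_eq_intros)
    from dd_chain[of f "\<lambda>s. (x, s *\<^sub>R y)", OF differentiable[OF f(1) zs[OF s]] this]
    have "((\<lambda>s. f (x, s *\<^sub>R y)) has_derivative (\<lambda>h. h * (f (x, s *\<^sub>R y) / s))) (at s)"
      using linear_scale[OF linear_dd[OF differentiable[OF f(1) zs[OF s]]], of _ "(0, y)"] by (simp add: e)
    then show "((\<lambda>s. f (x, s *\<^sub>R y) - s * f (x, y)) has_derivative
        (\<lambda>h. h * ((f (x, s *\<^sub>R y) - s * f (x, y)) / s))) (at s)"
      using s by (auto intro!: derivative_eq_intros simp: field_simps)
    show "\<bar>h * ((f (x, s *\<^sub>R y) - s * f (x, y)) / s)\<bar> \<le> 1 / s * \<bar>f (x, s *\<^sub>R y) - s * f (x, y)\<bar> * norm h" for h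
      using s by (simp add: abs_mult mult.commute)
  qed (use r in \<open>auto intro!: continuous_intros\<close>)
  then show ?thesis by simp
qed

text \<open>Along the characteristic \<open>x' \<mapsto> (x', y + p (x - x'))\<close> a solution of the transport equation
  satisfies a linear homogeneous system.\<close>

lemma characteristic_zero:
  assumes V: "open V" "connected V" "a \<in> V" "b \<in> V"
    and inS: "\<And>x'. x' \<in> V \<Longrightarrow> (x', y + p *\<^sub>R (x - x')) \<in> S"
    and f: "smooth f" and A: "\<And>l. smooth (A l)"
    and tr: "\<And>x' l. x' \<in> V \<Longrightarrow> dX l f (x', y + p *\<^sub>R (x - x')) - p * dY l f (x', y + p *\<^sub>R (x - x'))
      = A l (x', y + p *\<^sub>R (x - x')) * f (x', y + p *\<^sub>R (x - x'))"
    and zero: "f (a, y + p *\<^sub>R (x - a)) = 0"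
  shows "f (b, y + p *\<^sub>R (x - b)) = 0"
proof -
  define \<zeta> where "\<zeta> x' = (x', y + p *\<^sub>R (x - x'))" for x'
  have \<zeta>S: "\<zeta> x' \<in> S" if "x' \<in> V" for x' using inS[OF that] by (simp add: \<zeta>_def)
  have \<zeta>': "(\<zeta> has_derivative (\<lambda>h. (h, - p *\<^sub>R h))) (at x')" for x'
    unfolding \<zeta>_def[abs_def] by (auto intro!: derivative_eq_intros)
  have cont\<zeta>: "continuous_on V \<zeta>"
    using \<zeta>' has_derivative_continuous continuous_at_imp_continuous_on by blast
  have "f (\<zeta> b) = 0"
  proof (rule zero_if_derivative_bounded_by_self[where g = "\<lambda>x'. f (\<zeta> x')" and
        K = "\<lambda>x'. \<Sum>l\<in>UNIV. \<bar>A l (\<zeta> x')\<bar>", OF V(1-3) _ _ _ _ V(4)])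
    show "continuous_on V (\<lambda>x'. \<Sum>l\<in>UNIV. \<bar>A l (\<zeta> x')\<bar>)"
      using \<zeta>S
      by (intro continuous_intros continuous_on_compose2[OF C_infinity_on_continuous_on[OF A] cont\<zeta>]) blast
    fix x' assume x': "x' \<in> V"
    note d = differentiable[OF f \<zeta>S[OF x']]
    have "dd (h, - p *\<^sub>R h) f (\<zeta> x') = (\<Sum>l\<in>UNIV. h $ l * A l (\<zeta> x')) * f (\<zeta> x')" for h
    proof -
      have "(h, - p *\<^sub>R h) = (h, 0) + (- p) *\<^sub>R (0, h)" by simp
      then have "dd (h, - p *\<^sub>R h) f (\<zeta> x') = dd (h, 0) f (\<zeta> x') + (- p) * dd (0, h) f (\<zeta> x')"
        using linear_add[OF linear_dd[OF d]] linear_scale[OF linear_dd[OF d], of "- p" "(0, h)"]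
        by (metis real_scaleR_def)
      also have "\<dots> = (\<Sum>l\<in>UNIV. h $ l * (dX l f (\<zeta> x') - p * dY l f (\<zeta> x')))"
        unfolding dd_eq_sum_dX[OF d, of h] dd_eq_sum_dY[OF d, of h]
        by (simp add: algebra_simps sum_subtractf sum_distrib_left sum_negf)
      also have "\<dots> = (\<Sum>l\<in>UNIV. h $ l * (A l (\<zeta> x') * f (\<zeta> x')))"
        using tr[OF x'] by (simp add: \<zeta>_def)
      finally show ?thesis by (simp add: sum_distrib_right mult.assoc)
    qed
    then show "((\<lambda>x'. f (\<zeta> x')) has_derivative (\<lambda>h. (\<Sum>l\<in>UNIV. h $ l * A l (\<zeta> x')) * f (\<zeta> x'))) (at x')"
      using dd_chain[of f \<zeta>, OF d \<zeta>'] by simp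
    show "\<bar>(\<Sum>l\<in>UNIV. h $ l * A l (\<zeta> x')) * f (\<zeta> x')\<bar>
        \<le> (\<Sum>l\<in>UNIV. \<bar>A l (\<zeta> x')\<bar>) * \<bar>f (\<zeta> x')\<bar> * norm h" for h
    proof -
      have "\<bar>\<Sum>l\<in>UNIV. h $ l * A l (\<zeta> x')\<bar> \<le> (\<Sum>l\<in>UNIV. norm h * \<bar>A l (\<zeta> x')\<bar>)"
        by (rule order_trans[OF sum_abs sum_mono]) (simp add: abs_mult component_le_norm_cart mult_right_mono)
      then have "\<bar>\<Sum>l\<in>UNIV. h $ l * A l (\<zeta> x')\<bar> * \<bar>f (\<zeta> x')\<bar>
          \<le> (\<Sum>l\<in>UNIV. norm h * \<bar>A l (\<zeta> x')\<bar>) * \<bar>f (\<zeta> x')\<bar>"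
        by (rule mult_right_mono) simp
      then show ?thesis by (simp add: abs_mult algebra_simps flip: sum_distrib_left)
    qed
  qed (use zero in \<open>simp add: \<zeta>_def\<close>)
  then show ?thesis by (simp add: \<zeta>_def)
qed

text \<open>The characteristic is launched with the fixed slope \<open>p\<close>, so it is known
  explicitly before \<open>Q\<close> is known on it. The third conclusion is a comparison with
  \<open>weight Q\<close>, to be used for \<open>f = F\<close>.\<close>

lemma burgers_imp_implicit:
  assumes Q: "smooth Q" "euler 1 Q" "burgers Q"
    and U: "connected U" "0 \<in> U" "2 \<le> CARD('n)" and z: "(x, y) \<in> S"
  defines "p \<equiv> Q (x, y)"
  shows "y + p *\<^sub>R x \<noteq> 0" and "Q (0, y + p *\<^sub>R x) = p"
    and "smooth f \<Longrightarrow> (\<And>z l. z \<in> S \<Longrightarrow> dX l f z = Q z * dY l f z + dY l Q z * f z) \<Longrightarrow>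
      f (x, y) = f (0, y + p *\<^sub>R x) * weight Q (x, y)"
proof -
  define V where "V = {x' \<in> U. y + p *\<^sub>R (x - x') \<noteq> 0}"
  have V: "open V" "connected V"
  proof -
    have "open (U \<inter> (\<lambda>x'. y + p *\<^sub>R (x - x')) -` (- {0}))"
      by (intro open_Int open_U open_vimage continuous_intros)
    then show "open V" by (simp add: V_def Int_def vimage_def)
    show "connected V"
    proof (cases "p = 0")
      case True
      then show ?thesis using U z by (simp add: V_def)
    next
      case False
      have "y + p *\<^sub>R (x - x') = 0 \<longleftrightarrow> x' = x + (1 / p) *\<^sub>R y" for x'
      proof -
        have "y + p *\<^sub>R (x - x') = p *\<^sub>R ((x + (1 / p) *\<^sub>R y) - x')"
          using False by (simp add: algebra_simps)
        then show ?thesis using False by auto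
      qed
      then have "V = U - {x + (1 / p) *\<^sub>R y}" by (auto simp: V_def)
      then show ?thesis
        using connected_open_delete[OF open_U U(1)] U(3) by simp
    qed
  qed
  have inS: "(x', y + p *\<^sub>R (x - x')) \<in> S" if "x' \<in> V" for x'
    using that by (auto simp: V_def)
  have xV: "x \<in> V" using z by (simp add: V_def)
  have bur: "dX l Q w = Q w * dY l Q w" if "w \<in> S" for w l
    using Q(3) that unfolding burgers_def by blast
  have const: "Q (b, y + p *\<^sub>R (x - b)) = p" if "b \<in> V" for b
  proof -
    have "Q (b, y + p *\<^sub>R (x - b)) - p = 0"
    \<comment> \<open>The Burgers equation gives
      \<open>dX l Q - p * dY l Q = dY l Q * (Q - p)\<close>: linear in the deviation
      \<open>Q - p\<close>, which vanishes over \<open>x\<close>.\<close>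
    proof (rule characteristic_zero[OF V xV that inS, of "\<lambda>z. Q z - p" "\<lambda>l. dY l Q"])
      fix x' l assume x': "x' \<in> V"
      note zz = inS[OF x']
      show "dX l (\<lambda>z. Q z - p) (x', y + p *\<^sub>R (x - x')) - p * dY l (\<lambda>z. Q z - p) (x', y + p *\<^sub>R (x - x'))
        = dY l Q (x', y + p *\<^sub>R (x - x')) * (Q (x', y + p *\<^sub>R (x - x')) - p)"
        unfolding dd_rules(2)[OF zz Q(1) C_infinity_on_const] dd_const using bur[OF zz, of l]
        by (simp add: algebra_simps)
    qed (use Q(1) in \<open>auto simp: p_def intro: smooth_intros\<close>)
    then show ?thesis by simp
  qed
  \<comment> \<open>If \<open>y = - p x\<close>, the characteristic over \<open>t x\<close> carries
    the vector \<open>t (- p x)\<close>. Constancy and homogeneity give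
    \<open>t * Q (t x, - p x) = p\<close> for small positive \<open>t\<close>, while the left side
    tends to 0; but \<open>p\<close> is nonzero because \<open>y\<close> is.\<close>
  show ne: "y + p *\<^sub>R x \<noteq> 0"
  proof
    assume "y + p *\<^sub>R x = 0"
    then have y: "y = - p *\<^sub>R x" by (simp add: eq_neg_iff_add_eq_0)
    then have px: "p \<noteq> 0" "x \<noteq> 0" using z by auto
    have S0: "(0, - p *\<^sub>R x) \<in> S" using px U by auto
    have tU: "\<forall>\<^sub>F t in at_right 0. t *\<^sub>R x \<in> U"
    proof -
      have "((\<lambda>t. t *\<^sub>R x) \<longlongrightarrow> 0 *\<^sub>R x) (at_right 0)" by (intro tendsto_intros)
      then show ?thesis using topological_tendstoD[of _ "0 *\<^sub>R x" "at_right 0" U] open_U U by simp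
    qed
    have "\<forall>\<^sub>F t in at_right 0. t * Q (t *\<^sub>R x, - p *\<^sub>R x) = p"
      using tU eventually_at_right_less[of 0]
    proof eventually_elim
      case (elim t)
      have e: "y + p *\<^sub>R (x - t *\<^sub>R x) = t *\<^sub>R (- p *\<^sub>R x)" unfolding y by (simp add: algebra_simps)
      then have "t *\<^sub>R x \<in> V" using elim px by (simp add: V_def)
      from const[OF this] have "Q (t *\<^sub>R x, t *\<^sub>R (- p *\<^sub>R x)) = p" unfolding e .
      moreover have "(t *\<^sub>R x, - p *\<^sub>R x) \<in> S" using elim px by auto
      ultimately show ?case using homogeneous_if_euler[OF Q(1,2) _ elim(2)] by metis
    qed
    moreover have "((\<lambda>t. t * Q (t *\<^sub>R x, - p *\<^sub>R x)) \<longlongrightarrow> 0 * Q (0, - p *\<^sub>R x)) (at_right 0)"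
    proof (intro tendsto_mult tendsto_ident_at)
      have "isCont Q (0, - p *\<^sub>R x)"
        using differentiable[OF Q(1) S0] differentiable_imp_continuous_within by blast
      moreover have "((\<lambda>t. (t *\<^sub>R x, - p *\<^sub>R x)) \<longlongrightarrow> (0 *\<^sub>R x, - p *\<^sub>R x)) (at_right 0)"
        by (intro tendsto_intros)
      ultimately show "((\<lambda>t. Q (t *\<^sub>R x, - p *\<^sub>R x)) \<longlongrightarrow> Q (0, - p *\<^sub>R x)) (at_right 0)"
        using isCont_tendsto_compose[of "(0, - p *\<^sub>R x)" Q "\<lambda>t. (t *\<^sub>R x, - p *\<^sub>R x)" "at_right 0"]
        by simp
    qed
    ultimately have "((\<lambda>t. p) \<longlongrightarrow> 0) (at_right (0::real))"
      by (simp add: filterlim_cong[OF refl refl])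
    then show False using px by (simp add: tendsto_const_iff)
  qed
  then have V0: "0 \<in> V" using U by (simp add: V_def)
  show "Q (0, y + p *\<^sub>R x) = p" using const[OF V0] by simp
  assume f: "smooth f" and tr: "\<And>z l. z \<in> S \<Longrightarrow> dX l f z = Q z * dY l f z + dY l Q z * f z"
  \<comment> \<open>The weight is 1 over the origin, so with this constant
    \<open>f - C * weight Q\<close> vanishes there and the zero can be carried to
    \<open>x\<close>.\<close>
  define C where "C = f (0, y + p *\<^sub>R x)"
  note smW = smooth_weight[OF Q(1)]
  have dw: "dd v (\<lambda>z. f z - C * weight Q z) w = dd v f w - C * dd v (weight Q) w" if "w \<in> S" for v w
    using that f smW by (simp add: dd_rules smooth_intros)
  have "f (x, y + p *\<^sub>R (x - x)) - C * weight Q (x, y + p *\<^sub>R (x - x)) = 0"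
  proof (rule characteristic_zero[OF V V0 xV inS, of "\<lambda>z. f z - C * weight Q z" "\<lambda>l. dY l Q"])
    fix x' l assume x': "x' \<in> V"
    note zz = inS[OF x']
    show "dX l (\<lambda>z. f z - C * weight Q z) (x', y + p *\<^sub>R (x - x'))
        - p * dY l (\<lambda>z. f z - C * weight Q z) (x', y + p *\<^sub>R (x - x'))
      = dY l Q (x', y + p *\<^sub>R (x - x')) *
        (f (x', y + p *\<^sub>R (x - x')) - C * weight Q (x', y + p *\<^sub>R (x - x')))"
      unfolding dw[OF zz] tr[OF zz] weight_transport[OF Q(1,3) zz] const[OF x']
      by (simp add: algebra_simps)
  next
    show "smooth (\<lambda>z. f z - C * weight Q z)" by (intro smooth_intros f smW)
    show "smooth (dY l Q)" for l by (intro smooth_intros Q(1))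
  qed (simp_all add: C_def weight_def)
  then show "f (x, y) = f (0, y + p *\<^sub>R x) * weight Q (x, y)" by (simp add: C_def)
qed

end

section \<open>From the implicit equation back to the transport equations\<close>

context slit_bundle
begin

text \<open>With \<open>H = y + Q x\<close> and \<open>c = 1 - D\<phi>(H) x\<close>, differentiating \<open>Q = \<phi>(H)\<close> gives
  \<open>c DQ(a, b) = D\<phi>(H)(b + Q a)\<close>; hence \<open>c weight = 1\<close>, so \<open>c \<noteq> 0\<close>.\<close>

lemma implicit_imp_transport:
  assumes Q: "smooth Q"
    and \<phi>: "pos_homogeneous \<phi>" "C_infinity_on (UNIV - {0}) \<phi>" and \<psi>: "C_infinity_on (UNIV - {0}) \<psi>"
    and ne: "\<And>z. z \<in> S \<Longrightarrow> snd z + Q z *\<^sub>R fst z \<noteq> 0"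
    and Q\<phi>: "\<And>z. z \<in> S \<Longrightarrow> Q z = \<phi> (snd z + Q z *\<^sub>R fst z)"
    and F\<psi>: "\<And>z. z \<in> S \<Longrightarrow> F z = \<psi> (snd z + Q z *\<^sub>R fst z) * weight Q z"
  shows "euler 1 Q" and "burgers Q" and "z \<in> S \<Longrightarrow> dX l F z = dY l (\<lambda>z. Q z * F z) z"
proof -
  define H where "H z = snd z + Q z *\<^sub>R fst z" for z
  have H': "(H has_derivative (\<lambda>h. snd h + (Q z *\<^sub>R fst h + dd h Q z *\<^sub>R fst z))) (at z)" if "z \<in> S" for z
    unfolding H_def[abs_def] using has_derivative_dd[OF differentiable[OF Q that]]
    by (auto intro!: derivative_eq_intros)
  have chain: "((\<lambda>z. f (H z)) has_derivative
      (\<lambda>h. dd (snd h + (Q z *\<^sub>R fst h + dd h Q z *\<^sub>R fst z)) f (H z))) (at z)"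
    if "C_infinity_on (UNIV - {0}) f" "z \<in> S" for f z
    using dd_chain[of f H z, OF _ H'[OF that(2)]] C_infinity_on_differentiable[OF that(1), of "H z"]
      ne[OF that(2)] by (simp add: H_def)
  have key: "(\<forall>k. dX k Q z = Q z * dY k Q z) \<and> dd (0, snd z) Q z = Q z" if z: "z \<in> S" for z
  proof -
    have Hz: "H z \<noteq> 0" using ne[OF z] by (simp add: H_def)
    have d: "\<phi> differentiable (at (H z))"
      using C_infinity_on_differentiable[OF \<phi>(2)] Hz by simp
    note lin = linear_dd[OF d]
    define D where "D u = dd u \<phi> (H z)" for u
    define c where "c = 1 - D (fst z)"
    have D: "dd h Q z * c = D (snd h) + Q z * D (fst h)" for h
    proof -
      have "dd h Q z = dd h (\<lambda>z. \<phi> (H z)) z"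
        by (rule dd_S_cong[OF z]) (simp add: H_def Q\<phi>[symmetric])
      also have "\<dots> = D (snd h + (Q z *\<^sub>R fst h + dd h Q z *\<^sub>R fst z))"
        unfolding D_def by (rule dd_eqI[OF chain[OF \<phi>(2) z]])
      also have "\<dots> = D (snd h) + (Q z * D (fst h) + dd h Q z * D (fst z))"
        unfolding D_def linear_add[OF lin] linear_scale[OF lin] by simp
      finally show ?thesis by (simp add: c_def algebra_simps)
    qed
    have D0: "D 0 = 0" unfolding D_def by (rule linear_0[OF lin])
    have "weight Q z = 1 + dd (0, fst z) Q z"
      using dd_eq_sum_dY[OF differentiable[OF Q z], of "fst z"] by (simp add: weight_def mult.commute)
    then have "weight Q z * c = c + dd (0, fst z) Q z * c" by (simp add: algebra_simps)
    also have "\<dots> = 1" using D[of "(0, fst z)"] by (simp add: D0 c_def)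
    finally have c: "c \<noteq> 0" by auto
    have "dX k Q z * c = (Q z * dY k Q z) * c" for k
      using D[of "(axis k 1, 0)"] D[of "(0, axis k 1)"] by (simp add: D0 algebra_simps)
    then have "dX k Q z = Q z * dY k Q z" for k using c by (metis mult_right_cancel)
    moreover have "dd (0, snd z) Q z = Q z"
    proof -
      \<comment> \<open>Euler's identity for \<open>\<phi>\<close>, from its scaling along the ray
        through \<open>H z\<close>. Expanding \<open>D (H z)\<close> by linearity then gives
        \<open>D (snd z) = Q z * c\<close>.\<close>
      have "D (H z) = \<phi> (H z)"
      proof -
        have "((\<lambda>r. r *\<^sub>R H z) has_derivative (\<lambda>h. h *\<^sub>R H z)) (at (1::real))"
          by (auto intro!: derivative_eq_intros)
        from dd_chain[of \<phi> "\<lambda>r. r *\<^sub>R H z" 1, OF _ this] d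
        have "((\<lambda>r. \<phi> (r *\<^sub>R H z)) has_derivative (\<lambda>h. h * D (H z))) (at 1)"
          using linear_scale[OF lin] by (simp add: D_def)
        moreover have "((\<lambda>r. \<phi> (r *\<^sub>R H z)) has_derivative (\<lambda>h. h * \<phi> (H z))) (at 1)"
        proof (rule has_derivative_transform_within_open)
          show "((\<lambda>r. r * \<phi> (H z)) has_derivative (\<lambda>h. h * \<phi> (H z))) (at 1)"
            by (auto intro!: derivative_eq_intros)
          show "r * \<phi> (H z) = \<phi> (r *\<^sub>R H z)" if "r \<in> {0<..}" for r
            using \<phi>(1) that by (simp add: pos_homogeneous_def)
        qed auto
        ultimately have "(\<lambda>h. h * D (H z)) = (\<lambda>h. h * \<phi> (H z))"
          by (rule has_derivative_unique)
        from fun_cong[OF this, of 1] show ?thesis by simp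
      qed
      moreover have "D (H z) = D (snd z) + Q z * D (fst z)"
        unfolding D_def H_def[of z] linear_add[OF lin[unfolded H_def]] linear_scale[OF lin[unfolded H_def]] by simp
      ultimately have "D (snd z) = Q z * c"
        using Q\<phi>[OF z] by (simp add: c_def H_def algebra_simps)
      then show ?thesis using D[of "(0, snd z)"] c by (simp add: D0)
    qed
    ultimately show ?thesis by blast
  qed
  show "euler 1 Q"
    unfolding euler_def
  proof
    fix z assume z: "z \<in> S"
    show "(\<Sum>j\<in>UNIV. snd z $ j * dY j Q z) = 1 * Q z"
      using key[OF z] dd_eq_sum_dY[OF differentiable[OF Q z], of "snd z"] by simp
  qed
  show bur: "burgers Q" unfolding burgers_def using key by blast
  assume z: "z \<in> S"
  have d\<psi>: "(\<lambda>z. \<psi> (H z)) differentiable (at z)"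
    using chain[OF \<psi> z] unfolding differentiable_def by blast
  have dw: "weight Q differentiable (at z)"
    by (rule differentiable[OF smooth_weight[OF Q] z])
  have dQ: "Q differentiable (at z)" by (rule differentiable[OF Q z])
  have \<psi>': "dX l (\<lambda>z. \<psi> (H z)) z = Q z * dY l (\<lambda>z. \<psi> (H z)) z"
  proof -
    have d: "\<psi> differentiable (at (H z))"
      using C_infinity_on_differentiable[OF \<psi>] ne[OF z] by (simp add: H_def)
    have "dX l (\<lambda>z. \<psi> (H z)) z = dd (Q z *\<^sub>R axis l 1 + dX l Q z *\<^sub>R fst z) \<psi> (H z)"
      using dd_eqI[OF chain[OF \<psi> z], of "(axis l 1, 0)"] by simp
    \<comment> \<open>By the Burgers equation the \<open>x^l\<close>-derivative of \<open>H\<close>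
      is \<open>Q\<close> times its \<open>y^l\<close>-derivative, so every function of
      \<open>H\<close> obeys the same homogeneous transport equation.\<close>
    also have "Q z *\<^sub>R axis l 1 + dX l Q z *\<^sub>R fst z = Q z *\<^sub>R (axis l 1 + dY l Q z *\<^sub>R fst z)"
      using key[OF z] by (simp add: algebra_simps)
    also have "dd \<dots> \<psi> (H z) = Q z * dd (axis l 1 + dY l Q z *\<^sub>R fst z) \<psi> (H z)"
      using linear_scale[OF linear_dd[OF d]] by simp
    also have "dd (axis l 1 + dY l Q z *\<^sub>R fst z) \<psi> (H z) = dY l (\<lambda>z. \<psi> (H z)) z"
      using dd_eqI[OF chain[OF \<psi> z], of "(0, axis l 1)"] by simp
    finally show ?thesis .
  qed
  have F': "dd v F z = \<psi> (H z) * dd v (weight Q) z + dd v (\<lambda>z. \<psi> (H z)) z * weight Q z" for v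
  proof -
    have "dd v F z = dd v (\<lambda>z. \<psi> (H z) * weight Q z) z"
      by (rule dd_S_cong[OF z]) (simp add: H_def F\<psi>)
    then show ?thesis by (simp add: dd_mult[OF d\<psi> dw])
  qed
  have "F differentiable (at z)"
    by (rule differentiable_cong[OF open_S z, of "\<lambda>z. \<psi> (H z) * weight Q z"])
      (simp_all add: H_def[symmetric] F\<psi> differentiable_mult[OF d\<psi> dw])
  then have "dY l (\<lambda>z. Q z * F z) z = Q z * dY l F z + dY l Q z * F z"
    by (rule dd_mult[OF dQ])
  then show "dX l F z = dY l (\<lambda>z. Q z * F z) z"
    unfolding F' \<psi>' weight_transport[OF Q bur z] using F\<psi>[OF z]
    by (simp add: H_def[symmetric] algebra_simps)
qed

end

section \<open>Flag curvature\<close>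

context finsler
begin

definition straight_spray :: bool where
  "straight_spray \<longleftrightarrow> (\<forall>z\<in>S. \<forall>i. G i z = P z * snd z $ i)"

lemma straight_sprayD: "straight_spray \<Longrightarrow> z \<in> S \<Longrightarrow> G i z = P z * snd z $ i"
  unfolding straight_spray_def by blast

lemma riemann_straight:
  assumes G: straight_spray and z: "z \<in> S"
  shows "riemann G i k z =
    ((P z)\<^sup>2 - (\<Sum>j\<in>UNIV. snd z $ j * dX j P z)) * axis k 1 $ i
    + (2 * dX k P z - (\<Sum>j\<in>UNIV. snd z $ j * dX j (dY k P) z) - P z * dY k P z) * snd z $ i"
proof -
  have 1: "dd v (G i) z = dd v (\<lambda>z. P z * snd z $ i) z" if "z \<in> S" for v i z
    by (rule dd_S_cong[OF that straight_sprayD[OF G]])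
  have 2: "dd w (dd v (G i)) z = dd w (dd v (\<lambda>z. P z * snd z $ i)) z" for w v i
    by (rule dd_S_cong[OF z 1])
  have "riemann G i k z = riemann (\<lambda>i z. P z * snd z $ i) i k z"
    unfolding riemann_def 1[OF z] 2 straight_sprayD[OF G z] ..
  then show ?thesis using riemann_projective[OF smooth_P euler_P z] by simp
qed

definition flag_numerator :: "(real^'n) \<times> (real^'n) \<Rightarrow> real^'n \<Rightarrow> real" where
  "flag_numerator z u = (\<Sum>i\<in>UNIV. \<Sum>m\<in>UNIV. \<Sum>k\<in>UNIV. g z $ i $ m * riemann G i k z * u $ k * u $ m)"

definition gdot :: "(real^'n) \<times> (real^'n) \<Rightarrow> real^'n \<Rightarrow> real^'n \<Rightarrow> real" where
  "gdot z a b = (\<Sum>i\<in>UNIV. \<Sum>j\<in>UNIV. g z $ i $ j * a $ i * b $ j)"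

lemma gdot_eq_inner: "gdot z a b = a \<bullet> (g z *v b)"
  by (simp add: gdot_def inner_vec_def matrix_vector_mult_def sum_distrib_left algebra_simps)

lemma flag_numerator_straight:
  assumes G: straight_spray and z: "z \<in> S"
  shows "flag_numerator z u = ((P z)\<^sup>2 - (\<Sum>j\<in>UNIV. snd z $ j * dX j P z)) * gdot z u u
    + (\<Sum>k\<in>UNIV. (2 * dX k P z - (\<Sum>j\<in>UNIV. snd z $ j * dX j (dY k P) z) - P z * dY k P z) * u $ k)
      * gdot z (snd z) u"
proof -
  define R where "R = (P z)\<^sup>2 - (\<Sum>j\<in>UNIV. snd z $ j * dX j P z)"
  define \<tau> where "\<tau> k = 2 * dX k P z - (\<Sum>j\<in>UNIV. snd z $ j * dX j (dY k P) z) - P z * dY k P z" for k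
  have inner: "(\<Sum>k\<in>UNIV. g z $ i $ m * riemann G i k z * u $ k * u $ m)
      = R * (g z $ i $ m * u $ i * u $ m) + (\<Sum>k\<in>UNIV. \<tau> k * u $ k) * (g z $ i $ m * snd z $ i * u $ m)" for i m
  proof -
    have "(\<Sum>k\<in>UNIV. g z $ i $ m * riemann G i k z * u $ k * u $ m)
      = R * g z $ i $ m * u $ m * (\<Sum>k\<in>UNIV. axis k 1 $ i * u $ k)
        + (\<Sum>k\<in>UNIV. \<tau> k * u $ k) * (g z $ i $ m * snd z $ i * u $ m)"
      unfolding riemann_straight[OF G z] R_def[symmetric] \<tau>_def[symmetric]
      by (simp add: algebra_simps sum.distrib sum_distrib_left sum_distrib_right)
    then show ?thesis by (simp add: sum_axis algebra_simps)
  qed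
  show ?thesis
    unfolding flag_numerator_def inner gdot_def R_def[symmetric] \<tau>_def[symmetric]
    by (simp add: sum.distrib flip: sum_distrib_left)
qed

text \<open>Both coefficients vanish: with \<open>P_x = P P_y\<close>, Euler's identity turns the
  first into \<open>P^2 - P^2\<close> and the second into
  \<open>2 P P_y - P P_y - P P_y\<close>.\<close>

lemma flag_numerator_burgers:
  assumes G: straight_spray and bur: "burgers P" and z: "z \<in> S"
  shows "flag_numerator z u = 0"
proof -
  have b: "dX k P z = P z * dY k P z" for k using bur z unfolding burgers_def by blast
  have e1: "(\<Sum>j\<in>UNIV. snd z $ j * dY j P z) = P z" using eulerD[OF euler_P z] by simp
  have e2: "(\<Sum>j\<in>UNIV. snd z $ j * dY j (dY k P) z) = 0" for k
    using eulerD[OF euler_dY[OF smooth_P euler_P] z] by simp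
  have "(\<Sum>j\<in>UNIV. snd z $ j * dX j P z) = P z * (\<Sum>j\<in>UNIV. snd z $ j * dY j P z)"
    by (simp add: b sum_distrib_left algebra_simps)
  then have R: "(P z)\<^sup>2 - (\<Sum>j\<in>UNIV. snd z $ j * dX j P z) = 0"
    by (simp add: e1 power2_eq_square)
  have "(\<Sum>j\<in>UNIV. snd z $ j * dX j (dY k P) z)
      = P z * (\<Sum>j\<in>UNIV. snd z $ j * dY j (dY k P) z) + (\<Sum>j\<in>UNIV. snd z $ j * dY j P z) * dY k P z" for k
    unfolding burgers_dY[OF smooth_P bur z]
    by (simp add: sum_distrib_left sum_distrib_right sum.distrib algebra_simps)
  then have "2 * dX k P z - (\<Sum>j\<in>UNIV. snd z $ j * dX j (dY k P) z) - P z * dY k P z = 0" for k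
    by (simp add: e1 e2 b)
  then show ?thesis unfolding flag_numerator_straight[OF G z] R by simp
qed

text \<open>A nonzero \<open>u\<close> orthogonal to \<open>y\<close> for the form
  \<open>g z\<close> removes the rank one part of the numerator and the square in the denominator.
  What remains is the wanted coefficient times \<open>gdot z u u > 0\<close>, over a positive
  number.\<close>

lemma flat_if_flag_zero:
  assumes G: straight_spray
    and flag: "\<And>u. dim {snd z, u} = 2 \<Longrightarrow>
      flag_numerator z u / ((F z)\<^sup>2 * gdot z u u - (gdot z (snd z) u)\<^sup>2) = 0"
    and n: "2 \<le> CARD('n)" and z: "z \<in> S"
  shows "(P z)\<^sup>2 = (\<Sum>j\<in>UNIV. snd z $ j * dX j P z)"
proof -
  have sym: "gdot z a b = gdot z b a" for a b
    unfolding gdot_def by (subst sum.swap) (simp add: g_symmetric[OF z] algebra_simps)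
  have pos: "gdot z a a > 0" if "a \<noteq> 0" for a
    using g_pos[OF z that] by (simp add: gdot_eq_inner)
  have y: "snd z \<noteq> 0" using z by auto
  obtain u where u: "u \<noteq> 0" "orthogonal (g z *v snd z) u"
    using orthogonal_to_vector_exists[of "g z *v snd z"] n by auto
  have uy: "gdot z u (snd z) = 0"
    using u by (simp add: gdot_eq_inner orthogonal_def inner_commute)
  have "dim {snd z, u} = 2"
  proof -
    have "u \<notin> span {snd z}"
    proof
      assume "u \<in> span {snd z}"
      then obtain k where k: "u = k *\<^sub>R snd z" by (auto simp: span_singleton)
      then have "k * gdot z (snd z) (snd z) = 0" using uy by (simp add: gdot_eq_inner)
      then show False using pos[OF y] k u by auto
    qed
    then have "independent {u, snd z}" "u \<noteq> snd z"
      using y by (auto simp: independent_insert span_base)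
    then show ?thesis by (simp add: dim_eq_card_independent insert_commute)
  qed
  from flag[OF this] have "flag_numerator z u = 0"
    using F_nonzero[OF z] pos[OF u(1)] uy sym[of u "snd z"] by simp
  then have "((P z)\<^sup>2 - (\<Sum>j\<in>UNIV. snd z $ j * dX j P z)) * gdot z u u = 0"
    unfolding flag_numerator_straight[OF G z] using uy sym[of u "snd z"] by simp
  then show ?thesis using pos[OF u(1)] by simp
qed

end

section \<open>Curried functions\<close>

lemma (in slit_bundle) fundamental_matrix_eq:
  assumes f: "smooth (\<lambda>z. f z * f z / 2)" and z: "(x, y) \<in> S"
  shows "fundamental_matrix (curry f x) y = (\<chi> i j. dY j (dY i (\<lambda>z. f z * f z / 2)) (x, y))"
proof -
  have 1: "pd i (\<lambda>y. (curry f x y)\<^sup>2 / 2) y = dY i (\<lambda>z. f z * f z / 2) (x, y)" if "(x, y) \<in> S" for i x y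
    by (rule pd_y_eq[where f = "\<lambda>x y. (curry f x y)\<^sup>2 / 2", OF _ f that]) (simp add: power2_eq_square)
  have "pd j (\<lambda>y. pd i (\<lambda>y. (curry f x y)\<^sup>2 / 2) y) y = dY j (dY i (\<lambda>z. f z * f z / 2)) (x, y)" for i j
    by (rule pd_y_eq[where f = "\<lambda>x y. pd i (\<lambda>y. (curry f x y)\<^sup>2 / 2) y", OF 1 C_infinity_on_dd[OF f] z])
  then show ?thesis by (simp add: fundamental_matrix_def)
qed

context finsler
begin

lemma metric_tensor_eq: "(x, y) \<in> S \<Longrightarrow> metric_tensor (curry F) x y = g (x, y)"
  unfolding metric_tensor_def g_def by (rule fundamental_matrix_eq[OF smooth_energy])

lemma geodesic_coeff_eq:
  assumes z: "(x, y) \<in> S"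
  shows "geodesic_coeff (curry F) i x y = G i (x, y)"
proof -
  have sm: "smooth (\<lambda>z. F z * F z)" by (intro smooth_intros smooth_F)
  have 1: "pd m (\<lambda>x. (curry F x y)\<^sup>2) x = dX m (\<lambda>z. F z * F z) (x, y)" if "(x, y) \<in> S" for m x y
    by (rule pd_x_eq[where f = "\<lambda>x y. (curry F x y)\<^sup>2", OF _ sm that]) (simp add: power2_eq_square)
  have 2: "pd l (\<lambda>y. pd m (\<lambda>x. (curry F x y)\<^sup>2) x) y = dY l (dX m (\<lambda>z. F z * F z)) (x, y)" for l m
    by (rule pd_y_eq[where f = "\<lambda>x y. pd m (\<lambda>x. (curry F x y)\<^sup>2) x", OF 1 C_infinity_on_dd[OF sm] z])
  show ?thesis
    unfolding geodesic_coeff_def Let_def metric_tensor_eq[OF z] 1[OF z] 2 G_def spray_rhs_def by simp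
qed

lemma Riemann_coeff_eq:
  assumes z: "(x, y) \<in> S"
  shows "Riemann_coeff (curry F) i k x y = riemann G i k (x, y)"
proof -
  have 1: "pd k (\<lambda>x. geodesic_coeff (curry F) i x y) x = dX k (G i) (x, y)" for i k
    by (rule pd_x_eq[OF geodesic_coeff_eq smooth_G z])
  have 2: "pd k (\<lambda>y. geodesic_coeff (curry F) i x y) y = dY k (G i) (x, y)" if "(x, y) \<in> S" for i k x y
    by (rule pd_y_eq[OF geodesic_coeff_eq smooth_G that])
  have 3: "pd j (\<lambda>x. pd k (\<lambda>y. geodesic_coeff (curry F) i x y) y) x = dX j (dY k (G i)) (x, y)" for i j k
    by (rule pd_x_eq[where f = "\<lambda>x y. pd k (\<lambda>y. geodesic_coeff (curry F) i x y) y",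
          OF 2 C_infinity_on_dd[OF smooth_G] z])
  have 4: "pd j (\<lambda>y. pd k (\<lambda>y. geodesic_coeff (curry F) i x y) y) y = dY j (dY k (G i)) (x, y)" for i j k
    by (rule pd_y_eq[where f = "\<lambda>x y. pd k (\<lambda>y. geodesic_coeff (curry F) i x y) y",
          OF 2 C_infinity_on_dd[OF smooth_G] z])
  show ?thesis
    using 1 2[OF z] 3 4 geodesic_coeff_eq[OF z]
    unfolding Riemann_coeff_def Let_def riemann_def by simp
qed

lemma flag_curvature_eq:
  assumes z: "(x, y) \<in> S"
  shows "flag_curvature (curry F) x y u = flag_numerator (x, y) u /
    ((F (x, y))\<^sup>2 * gdot (x, y) u u - (gdot (x, y) y u)\<^sup>2)"
  unfolding flag_curvature_def Let_def metric_tensor_eq[OF z] Riemann_coeff_eq[OF z]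
    flag_numerator_def gdot_def by simp

lemma straight_if_projectively_flat:
  assumes flat: "projectively_flat U (curry F)" and z: "z \<in> S"
  shows "\<exists>p. \<forall>i. G i z = p * snd z $ i"
proof (rule straight_if_geodesics_collinear[OF _ z])
  fix J c v
  assume J: "open J" "is_interval J" and sol: "\<forall>t\<in>J. c t \<in> U \<and> v t \<noteq> 0 \<and>
    (c has_vector_derivative v t) (at t) \<and> (v has_vector_derivative (\<chi> i. - 2 * G i (c t, v t))) (at t)"
  have "(\<chi> i. - 2 * geodesic_coeff (curry F) i (c t) (v t)) = (\<chi> i. - 2 * G i (c t, v t))" if "t \<in> J" for t
    using geodesic_coeff_eq[of "c t" "v t"] sol that by simp
  then have "geodesic U (curry F) J c"
    unfolding geodesic_def using J sol by (intro conjI exI[of _ v]) auto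
  then show "collinear (c ` J)" using flat unfolding projectively_flat_def by blast
qed

lemma projectively_flat_if_straight:
  assumes G: straight_spray
  shows "projectively_flat U (curry F)"
  unfolding projectively_flat_def
proof (intro allI impI)
  fix J c assume "geodesic U (curry F) J c"
  then obtain v where J: "open J" "is_interval J" and v: "\<And>t. t \<in> J \<Longrightarrow> c t \<in> U \<and> v t \<noteq> 0 \<and>
      (c has_vector_derivative v t) (at t) \<and>
      (v has_vector_derivative (\<chi> i. - 2 * geodesic_coeff (curry F) i (c t) (v t))) (at t)"
    unfolding geodesic_def by blast
  have "(\<chi> i. - 2 * geodesic_coeff (curry F) i (c t) (v t)) = (- 2 * P (c t, v t)) *\<^sub>R v t" if "t \<in> J" for t
    using geodesic_coeff_eq[of "c t" "v t"] straight_sprayD[OF G, of "(c t, v t)"] v[OF that] by (simp add: vec_eq_iff)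
  then show "collinear (c ` J)"
    using v by (intro collinear_if_straight[OF smooth_P J, of c v]) auto
qed

lemma P_eq_pd:
  assumes z: "(x, y) \<in> S"
  shows "P (x, y) = (\<Sum>k\<in>UNIV. pd_x k (curry F) x y * y $ k) / (2 * F (x, y))"
proof -
  have "pd k (\<lambda>x. curry F x y) x = dX k F (x, y)" for k
    by (rule pd_x_eq[OF _ smooth_F z]) simp
  then show ?thesis by (simp add: P_def mult.commute)
qed

lemma weight_eq_pd:
  assumes Q: "smooth Q" and z: "(x, y) \<in> S"
  shows "weight Q (x, y) = 1 + (\<Sum>k\<in>UNIV. pd_y k (curry Q) x y * x $ k)"
proof -
  have eq: "pd k (curry Q x) y = dY k Q (x, y)" for k
    by (rule pd_y_eq[OF _ Q z]) simp
  show ?thesis unfolding weight_def eq by simp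
qed

section \<open>The two implications and the values over the origin\<close>

lemma represents_if_flat:
  assumes U: "connected U" "0 \<in> U" and n: "2 \<le> CARD('n)"
    and Minkowski: "Minkowski_norm (curry F 0)"
    and flat: "projectively_flat U (curry F)" "zero_flag_curvature U (curry F)"
  shows "represents U (curry F) (curry F 0) (\<lambda>y. if y = 0 then 0 else P (0, y)) (curry P)"
proof -
  note straight = straight_if_projectively_flat[OF flat(1)]
  have hamel: "hamel P" and G: straight_spray
    using straight_imp_projective[OF straight] unfolding straight_spray_def by blast+
  have P2: "(P z)\<^sup>2 = (\<Sum>j\<in>UNIV. snd z $ j * dX j P z)" if z: "z \<in> S" for z
  proof (rule flat_if_flag_zero[OF G _ n z])
    fix u assume "dim {snd z, u} = 2"
    then have "flag_curvature (curry F) (fst z) (snd z) u = 0"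
      using flat(2) z unfolding zero_flag_curvature_def by auto
    then show "flag_numerator z u / ((F z)\<^sup>2 * gdot z u u - (gdot z (snd z) u)\<^sup>2) = 0"
      using flag_curvature_eq[of "fst z" "snd z" u] z by simp
  qed
  have bur: "burgers P"
    unfolding burgers_def using flat_imp_burgers[OF hamel P2] by blast
  have F_tr: "dX l F z = P z * dY l F z + dY l P z * F z" if "z \<in> S" for z l
  proof -
    have "dX l F z = dY l (\<lambda>z. P z * F z) z" using hamel that unfolding hamel_def by blast
    then show ?thesis using dd_rules(3)[OF that smooth_P smooth_F] by simp
  qed
  \<comment> \<open>Homogeneity forces the value 0 at the origin; the facts about \<open>P\<close>
    hold off the zero section only.\<close>
  define \<phi> where "\<phi> y = (if y = 0 then 0 else P (0, y))" for y
  have "pos_homogeneous \<phi>"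
    unfolding pos_homogeneous_def
  proof (intro allI impI)
    fix y :: "real^'n" and r :: real assume r: "r > 0"
    show "\<phi> (r *\<^sub>R y) = r * \<phi> y"
      using homogeneous_if_euler[OF smooth_P euler_P, of 0 y r] U r by (simp add: \<phi>_def)
  qed
  moreover have "C_infinity_on (UNIV - {0}) \<phi>"
  proof (rule C_infinity_on_cong)
    show "C_infinity_on (UNIV - {0}) (\<lambda>y. P (0 + (0, y)))"
      by (rule C_infinity_on_affine[OF open_S _ _ _ smooth_P])
        (use U in \<open>auto intro!: bounded_linear_intros\<close>)
  qed (auto simp: \<phi>_def)
  moreover have "C_infinity_on S (\<lambda>(x, y). curry P x y)" using smooth_P by simp
  moreover have "curry P x y = \<phi> (y + curry P x y *\<^sub>R x) \<and>
      curry F x y = curry F 0 (y + curry P x y *\<^sub>R x) * (1 + (\<Sum>k\<in>UNIV. pd_y k (curry P) x y * x $ k))"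
    if "x \<in> U" "y \<noteq> 0" for x y
  proof -
    have z: "(x, y) \<in> S" using that by simp
    note implicit = burgers_imp_implicit[OF smooth_P euler_P bur U n z]
    show ?thesis
      using implicit(1,2) implicit(3)[OF smooth_F F_tr] weight_eq_pd[OF smooth_P z]
      by (simp add: \<phi>_def)
  qed
  ultimately show ?thesis
    unfolding represents_def \<phi>_def[symmetric, abs_def] using Minkowski by blast
qed

text \<open>That \<open>Q\<close> has degree one and satisfies Hamel's equation comes out of the
  implicit equation; \<open>projective_factor_unique\<close> then identifies \<open>Q\<close> with
  \<open>P\<close>, and the equations pass to \<open>P\<close> because derivatives on the open set
  \<open>S\<close> depend on values in \<open>S\<close> only.\<close>

lemma represents_imp_burgers:
  assumes rep: "represents U (curry F) \<psi> \<phi> Q"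
  shows "hamel P" and "burgers P" and "\<And>x y. (x, y) \<in> S \<Longrightarrow> Q x y = P (x, y)"
proof -
  let ?Q = "\<lambda>(x, y). Q x y"
  have \<psi>: "Minkowski_norm \<psi>" and \<phi>: "pos_homogeneous \<phi>" "C_infinity_on (UNIV - {0}) \<phi>"
    and Q: "smooth ?Q"
    and eqs: "\<And>x y. (x, y) \<in> S \<Longrightarrow> Q x y = \<phi> (y + Q x y *\<^sub>R x) \<and>
        curry F x y = \<psi> (y + Q x y *\<^sub>R x) * (1 + (\<Sum>k\<in>UNIV. pd_y k Q x y * x $ k))"
    using rep unfolding represents_def by auto
  have \<psi>': "C_infinity_on (UNIV - {0}) \<psi>" "\<psi> 0 = 0"
    using \<psi> unfolding Minkowski_norm_def by auto
  have F\<psi>: "F z = \<psi> (snd z + ?Q z *\<^sub>R fst z) * weight ?Q z" if "z \<in> S" for z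
    using eqs[of "fst z" "snd z"] weight_eq_pd[OF Q, of "fst z" "snd z"] that
    by (simp add: case_prod_beta)
  have Q\<phi>: "?Q z = \<phi> (snd z + ?Q z *\<^sub>R fst z)" if "z \<in> S" for z
    using eqs[of "fst z" "snd z"] that by (simp add: case_prod_beta)
  \<comment> \<open>At a zero of \<open>y + Q x\<close> the formula would give \<open>F = 0\<close>,
    as \<open>\<psi> 0 = 0\<close>.\<close>
  have ne: "snd z + ?Q z *\<^sub>R fst z \<noteq> 0" if "z \<in> S" for z
    using F\<psi>[OF that] F_nonzero[OF that] \<psi>'(2) by auto
  note transport = implicit_imp_transport[OF Q \<phi> \<psi>'(1) ne Q\<phi> F\<psi>]
  have hamelQ: "hamel ?Q" unfolding hamel_def using transport(3) by blast
  have QP: "?Q z = P z" if "z \<in> S" for z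
    by (rule projective_factor_unique[OF Q transport(1) hamelQ that])
  show "Q x y = P (x, y)" if "(x, y) \<in> S" for x y using QP[OF that] by simp
  show "hamel P"
    unfolding hamel_def
  proof (intro ballI allI)
    fix z l assume z: "z \<in> S"
    have "dX l F z = dY l (\<lambda>z. ?Q z * F z) z" using hamelQ z unfolding hamel_def by blast
    also have "\<dots> = dY l (\<lambda>z. P z * F z) z" by (rule dd_S_cong[OF z]) (simp only: QP)
    finally show "dX l F z = dY l (\<lambda>z. P z * F z) z" .
  qed
  show "burgers P"
    unfolding burgers_def
  proof (intro ballI allI)
    fix z k assume z: "z \<in> S"
    have "dd v ?Q z = dd v P z" for v by (rule dd_S_cong[OF z QP])
    moreover have "dX k ?Q z = ?Q z * dY k ?Q z" using transport(2) z unfolding burgers_def by blast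
    ultimately show "dX k P z = P z * dY k P z"
      unfolding QP[OF z] by simp
  qed
qed

lemma flat_if_represents:
  assumes rep: "represents U (curry F) \<psi> \<phi> Q"
  shows "projectively_flat U (curry F)" and "zero_flag_curvature U (curry F)"
proof -
  note bur = represents_imp_burgers[OF rep]
  have G: straight_spray
    unfolding straight_spray_def using hamel_imp_straight[OF bur(1)] by blast
  show "projectively_flat U (curry F)" by (rule projectively_flat_if_straight[OF G])
  show "zero_flag_curvature U (curry F)"
    unfolding zero_flag_curvature_def
  proof (intro ballI allI impI)
    fix x y u :: "real^'n" assume x: "x \<in> U" and d: "dim {y, u} = 2"
    have "y \<noteq> 0"
    proof
      assume "y = 0"
      then have "dim {y, u} \<le> card {u}"
        by (intro dim_le_card) (auto intro: span_base span_zero)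
      then show False using d by simp
    qed
    then have z: "(x, y) \<in> S" using x by simp
    show "flag_curvature (curry F) x y u = 0"
      unfolding flag_curvature_eq[OF z] flag_numerator_burgers[OF G bur(2) z] by simp
  qed
qed

text \<open>Over \<open>x = 0\<close> the vector \<open>y + P x\<close> is \<open>y\<close> and the
  weight is 1, so both equations collapse. \<open>represents\<close> is silent about
  \<open>y = 0\<close>, hence the separate value \<open>curry F 0 0 = 0\<close>.\<close>

lemma represents_at_zero:
  assumes rep: "represents U (curry F) \<psi> \<phi> Q" and U: "0 \<in> U" and F0: "curry F 0 0 = 0"
  shows "\<psi> y = curry F 0 y"
    and "y \<noteq> 0 \<Longrightarrow> \<phi> y = Q 0 y"
    and "y \<noteq> 0 \<Longrightarrow> Q 0 y = (\<Sum>k\<in>UNIV. pd_x k (curry F) 0 y * y $ k) / (2 * curry F 0 y)"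
proof -
  have "\<psi> 0 = 0" using rep by (simp add: represents_def Minkowski_norm_def)
  then show "\<psi> y = curry F 0 y"
    using rep U F0 by (cases "y = 0") (simp_all add: represents_def)
  assume y: "y \<noteq> 0"
  then show "\<phi> y = Q 0 y" using rep U unfolding represents_def by fastforce
  show "Q 0 y = (\<Sum>k\<in>UNIV. pd_x k (curry F) 0 y * y $ k) / (2 * curry F 0 y)"
    using represents_imp_burgers(3)[OF rep, of 0 y] P_eq_pd[of 0 y] y U by simp
qed

end

lemma finsler_if_Finsler_metric:
  assumes "open U" and F: "Finsler_metric U F"
  shows "finsler U (\<lambda>(x, y). F x y)"
proof -
  interpret slit_bundle U by unfold_locales fact
  let ?F = "\<lambda>(x, y). F x y"
  have sm: "smooth ?F" and M: "\<And>x. x \<in> U \<Longrightarrow> Minkowski_norm (F x)"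
    using F by (auto simp: Finsler_metric_def)
  have sme: "smooth (\<lambda>z. ?F z * ?F z / 2)"
    by (intro C_infinity_on_divide open_S smooth_intros sm) simp
  show ?thesis
  proof
    show "smooth ?F" by fact
    show "0 < ?F z" if "z \<in> S" for z
    proof -
      have "0 \<le> F (fst z) (snd z)" "F (fst z) (snd z) \<noteq> 0"
        using M[of "fst z"] that unfolding Minkowski_norm_def by auto
      then show ?thesis by (simp add: case_prod_beta)
    qed
    show "euler 1 ?F"
      by (rule euler_if_homogeneous[OF sm])
        (use M in \<open>auto simp: Minkowski_norm_def pos_homogeneous_def\<close>)
    show "0 < v \<bullet> ((\<chi> i j. dY j (dY i (\<lambda>z. ?F z * ?F z / 2)) z) *v v)"
      if "z \<in> S" "v \<noteq> 0" for z v
    proof -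
      have "fst z \<in> U" "snd z \<noteq> 0" using that by auto
      then have "0 < v \<bullet> (fundamental_matrix (F (fst z)) (snd z) *v v)"
        using M[of "fst z"] that unfolding Minkowski_norm_def by blast
      moreover have "curry ?F (fst z) = F (fst z)" "(fst z, snd z) \<in> S"
        using that by auto
      ultimately show ?thesis
        using fundamental_matrix_eq[OF sme, of "fst z" "snd z"] by (simp only: prod.collapse)
    qed
  qed
qed

theorem theorem1p1:
  fixes F :: "real^'n \<Rightarrow> real^'n \<Rightarrow> real" and U :: "(real^'n) set"
  assumes "2 \<le> CARD('n)"
    and "open U" and "connected U" and "0 \<in> U"
    and "Finsler_metric U F"
  shows "(projectively_flat U F \<and> zero_flag_curvature U F
            \<longleftrightarrow> (\<exists>\<psi> \<phi> P. represents U F \<psi> \<phi> P)) \<and>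
         (\<forall>\<psi> \<phi> P. represents U F \<psi> \<phi> P \<longrightarrow>
            (\<forall>y. \<psi> y = F 0 y) \<and>
            (\<forall>y. y \<noteq> 0 \<longrightarrow>
               \<phi> y = P 0 y \<and>
               P 0 y = (\<Sum>k\<in>UNIV. pd_x k F 0 y * y $ k) / (2 * F 0 y)))"
proof -
  interpret finsler U "\<lambda>(x, y). F x y"
    by (rule finsler_if_Finsler_metric[OF assms(2,5)])
  have curry: "curry (\<lambda>(x, y). F x y) = F" by simp
  have Minkowski: "Minkowski_norm (F 0)"
    using assms(4,5) by (simp add: Finsler_metric_def)
  then have F0: "F 0 0 = 0" by (simp add: Minkowski_norm_def)
  note forward = represents_if_flat[unfolded curry, OF assms(3,4,1) Minkowski]
  note backward = flat_if_represents[unfolded curry]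
  note zero = represents_at_zero[unfolded curry, OF _ assms(4) F0]
  show ?thesis
    using forward backward zero by blast
qed

end
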